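(* Let $G$ be a GBS group represented by a connected labelled graph $\Gamma$. The rank of $G$ (the minimal cardinality of a generating set of $G$) is $\beta(\Gamma)+\mu(\Gamma)$, where $\beta(\Gamma)$ is the first Betti number of $\Gamma$ and $\mu(\Gamma)$ is the minimal cardinality of a set of vertices of $\Gamma$ meeting every plateau of $\Gamma$.
   Context: A labelled graph is a finite graph $\Gamma$ (loops and multiple edges allowed) in which each oriented edge $e$ carries a label $\lambda_e$, a nonzero integer (possibly negative). We denote by $o(e)$ the origin of $e$ and by $\tilde e$ the edge $e$ with the opposite orientation; $\lambda_e$ is called the label of $e$ near $o(e)$. A connected labelled graph defines a graph of groups in which all vertex and edge groups are $\mathbb{Z}$ and the inclusion from the edge group $G_e$ (with $G_e=G_{\tilde e}$) into the vertex group $G_{o(e)}$ is multiplication by $\lambda_e$. The fundamental group $G$ of this graph of groups is the generalized Baumslag-Solitar (GBS) group represented by $\Gamma$. Let $p$ be a prime. A non-empty connected subgraph $P\subset\Gamma$ is a $p$-plateau if for every oriented edge $e$ of $\Gamma$ with $o(e)\in P$: the label $\lambda_e$ is divisible by $p$ if and only if $e$ is not contained in $P$. A plateau is a subgraph that is a $p$-plateau for some prime $p$ (the whole graph $\Gamma$ is allowed). *)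

theory Defs
  imports
    "Graph_Theory.Bidirected_Digraph"
    "Graph_Theory.Digraph_Component"
    "HOL-Algebra.Elementary_Groups"
    "HOL-Algebra.Generated_Groups"
    "HOL-Computational_Algebra.Primes"
    "HOL-Library.Extended_Nat"
    "HOL-Library.Function_Algebras"
begin

text \<open>
  Graphs are graphs in the sense of Serre: the arcs of a \<^locale>\<open>bidirected_digraph\<close> are the
  \<^emph>\<open>oriented\<close> edges, \<open>tail \<Gamma> e\<close> is the origin \<open>o(e)\<close>, and \<open>arev e\<close> is the edge \<open>e\<close> with the
  opposite orientation. So each geometric edge (loops included) consists of two distinct arcs.
  A subgraph must be closed under \<open>arev\<close>, which the library's \<^const>\<open>subgraph\<close> does not require.
\<close>

definition serre_subgraph ::
  "('v, 'e) pre_digraph \<Rightarrow> ('v, 'e) pre_digraph \<Rightarrow> ('e \<Rightarrow> 'e) \<Rightarrow> bool" where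
  "serre_subgraph P \<Gamma> arev \<longleftrightarrow> subgraph P \<Gamma> \<and> arev ` arcs P \<subseteq> arcs P"

text \<open>
  The library's \<^const>\<open>tree\<close> is not usable here: it forbids directed cycles, and \<open>[e, arev e]\<close>
  is one. In a Serre tree these backtrackings are the only ones. Note that
  \<^const>\<open>connected\<close> includes non-emptiness.
\<close>

definition serre_tree :: "('v, 'e) pre_digraph \<Rightarrow> ('e \<Rightarrow> 'e) \<Rightarrow> bool" where
  "serre_tree T arev \<longleftrightarrow>
     connected T \<and> (\<forall>p. pre_digraph.cycle T p \<longrightarrow> (\<exists>e. p = [e, arev e]))"

definition maximal_subtree ::
  "('v, 'e) pre_digraph \<Rightarrow> ('v, 'e) pre_digraph \<Rightarrow> ('e \<Rightarrow> 'e) \<Rightarrow> bool" where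
  "maximal_subtree T \<Gamma> arev \<longleftrightarrow>
     serre_subgraph T \<Gamma> arev \<and> spanning T \<Gamma> \<and> serre_tree T arev"


section \<open>Graphs of groups\<close>

record ('v, 'e, 'g, 'h) graph_of_groups =
  base :: "('v, 'e) pre_digraph"
  brev :: "'e \<Rightarrow> 'e"
  vgroup :: "'v \<Rightarrow> 'g monoid"
  egroup :: "'e \<Rightarrow> 'h monoid"
  incl :: "'e \<Rightarrow> 'h \<Rightarrow> 'g"

locale graph_of_groups = bidirected_digraph "base \<G>" "brev \<G>"
  for \<G> :: "('v, 'e, 'g, 'h) graph_of_groups" +
  assumes group_vgroup: "v \<in> verts (base \<G>) \<Longrightarrow> group (vgroup \<G> v)"
    and group_egroup: "e \<in> arcs (base \<G>) \<Longrightarrow> group (egroup \<G> e)"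
    and egroup_brev: "e \<in> arcs (base \<G>) \<Longrightarrow> egroup \<G> (brev \<G> e) = egroup \<G> e"
    and incl_mon: "e \<in> arcs (base \<G>) \<Longrightarrow>
      incl \<G> e \<in> mon (egroup \<G> e) (vgroup \<G> (tail (base \<G>) e))"

datatype ('v, 'e, 'g) letter = VLetter 'v 'g | ELetter 'e

definition gog_words :: "('v, 'e, 'g, 'h) graph_of_groups \<Rightarrow> ('v, 'e, 'g) letter list set" where
  "gog_words \<G> = lists
     ({VLetter v g | v g. v \<in> verts (base \<G>) \<and> g \<in> carrier (vgroup \<G> v)}
      \<union> ELetter ` arcs (base \<G>))"

text \<open>
  The fundamental group of \<open>\<G>\<close> relative to a maximal subtree \<open>T\<close> is generated by the vertex groups
  and the oriented edges, subject to the relations of the vertex groups, \<open>e\<inverse> = arev e\<close>,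
  \<open>e \<cdot> incl (arev e) c \<cdot> e\<inverse> = incl e c\<close> for \<open>c\<close> in the edge group of \<open>e\<close>, and \<open>e = 1\<close> for \<open>e\<close> in \<open>T\<close>.
  Since the letters already contain all inverses, a monoid presentation suffices.
\<close>

inductive gog_relation ::
  "('v, 'e, 'g, 'h) graph_of_groups \<Rightarrow> ('v, 'e) pre_digraph \<Rightarrow>
   ('v, 'e, 'g) letter list \<Rightarrow> ('v, 'e, 'g) letter list \<Rightarrow> bool"
  for \<G> T where
  vertex_mult: "\<lbrakk>v \<in> verts (base \<G>); g \<in> carrier (vgroup \<G> v); h \<in> carrier (vgroup \<G> v)\<rbrakk> \<Longrightarrow>
     gog_relation \<G> T [VLetter v g, VLetter v h] [VLetter v (g \<otimes>\<^bsub>vgroup \<G> v\<^esub> h)]"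
| vertex_one: "v \<in> verts (base \<G>) \<Longrightarrow>
     gog_relation \<G> T [VLetter v \<one>\<^bsub>vgroup \<G> v\<^esub>] []"
| edge_inverse: "e \<in> arcs (base \<G>) \<Longrightarrow>
     gog_relation \<G> T [ELetter e, ELetter (brev \<G> e)] []"
| edge_conj: "\<lbrakk>e \<in> arcs (base \<G>); c \<in> carrier (egroup \<G> e)\<rbrakk> \<Longrightarrow>
     gog_relation \<G> T
       [ELetter e, VLetter (head (base \<G>) e) (incl \<G> (brev \<G> e) c), ELetter (brev \<G> e)]
       [VLetter (tail (base \<G>) e) (incl \<G> e c)]"
| tree_edge: "e \<in> arcs T \<Longrightarrow> gog_relation \<G> T [ELetter e] []"

inductive gog_cong ::
  "('v, 'e, 'g, 'h) graph_of_groups \<Rightarrow> ('v, 'e) pre_digraph \<Rightarrow>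
   ('v, 'e, 'g) letter list \<Rightarrow> ('v, 'e, 'g) letter list \<Rightarrow> bool"
  for \<G> T where
  base: "gog_relation \<G> T u w \<Longrightarrow> gog_cong \<G> T u w"
| refl: "gog_cong \<G> T u u"
| sym: "gog_cong \<G> T u w \<Longrightarrow> gog_cong \<G> T w u"
| trans: "gog_cong \<G> T u w \<Longrightarrow> gog_cong \<G> T w x \<Longrightarrow> gog_cong \<G> T u x"
| append: "gog_cong \<G> T u u' \<Longrightarrow> gog_cong \<G> T w w' \<Longrightarrow> gog_cong \<G> T (u @ w) (u' @ w')"

definition gog_class ::
  "('v, 'e, 'g, 'h) graph_of_groups \<Rightarrow> ('v, 'e) pre_digraph \<Rightarrow>
   ('v, 'e, 'g) letter list \<Rightarrow> ('v, 'e, 'g) letter list set" where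
  "gog_class \<G> T u = {w. gog_cong \<G> T u w}"

definition fundamental_group ::
  "('v, 'e, 'g, 'h) graph_of_groups \<Rightarrow> ('v, 'e) pre_digraph \<Rightarrow>
   ('v, 'e, 'g) letter list set monoid" where
  "fundamental_group \<G> T =
     \<lparr>carrier = gog_class \<G> T ` gog_words \<G>,
      monoid.mult = (\<lambda>A B. \<Union>u\<in>A. \<Union>w\<in>B. gog_class \<G> T (u @ w)),
      one = gog_class \<G> T []\<rparr>"

lemma gog_words_append:
  "u \<in> gog_words \<G> \<Longrightarrow> w \<in> gog_words \<G> \<Longrightarrow> u @ w \<in> gog_words \<G>"
  by (simp add: gog_words_def)

lemma gog_class_eq_iff: "gog_class \<G> T u = gog_class \<G> T w \<longleftrightarrow> gog_cong \<G> T u w"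
  unfolding gog_class_def by (blast intro: gog_cong.refl gog_cong.sym gog_cong.trans)

lemma fundamental_group_mult:
  "gog_class \<G> T u \<otimes>\<^bsub>fundamental_group \<G> T\<^esub> gog_class \<G> T w = gog_class \<G> T (u @ w)"
  by (auto simp: fundamental_group_def gog_class_def
      intro: gog_cong.refl gog_cong.sym gog_cong.trans gog_cong.append)

lemma (in graph_of_groups) group_fundamental_group: "group (fundamental_group \<G> T)"
proof (rule groupI)
  let ?F = "fundamental_group \<G> T"
  have carr: "carrier ?F = gog_class \<G> T ` gog_words \<G>"
    and one: "\<one>\<^bsub>?F\<^esub> = gog_class \<G> T []"
    by (simp_all add: fundamental_group_def)
  show "x \<otimes>\<^bsub>?F\<^esub> y \<in> carrier ?F" if "x \<in> carrier ?F" "y \<in> carrier ?F" for x y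
    using that unfolding carr
    by (auto simp: fundamental_group_mult gog_words_append)
  show "\<one>\<^bsub>?F\<^esub> \<in> carrier ?F"
    by (simp add: carr one gog_words_def)
  show "x \<otimes>\<^bsub>?F\<^esub> y \<otimes>\<^bsub>?F\<^esub> z = x \<otimes>\<^bsub>?F\<^esub> (y \<otimes>\<^bsub>?F\<^esub> z)"
    if "x \<in> carrier ?F" "y \<in> carrier ?F" "z \<in> carrier ?F" for x y z
    using that unfolding carr by (auto simp: fundamental_group_mult)
  show "\<one>\<^bsub>?F\<^esub> \<otimes>\<^bsub>?F\<^esub> x = x" if "x \<in> carrier ?F" for x
    using that unfolding carr by (auto simp: fundamental_group_mult one)
  have letter_inv: "\<exists>b. [b] \<in> gog_words \<G> \<and> gog_cong \<G> T [b, a] []"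
    if "[a] \<in> gog_words \<G>" for a
  proof (cases a)
    case (VLetter v g)
    with that have v: "v \<in> verts (base \<G>)" and g: "g \<in> carrier (vgroup \<G> v)"
      by (auto simp: gog_words_def)
    interpret V: group "vgroup \<G> v" by (rule group_vgroup[OF v])
    have "gog_cong \<G> T [VLetter v (inv\<^bsub>vgroup \<G> v\<^esub> g), a] [VLetter v \<one>\<^bsub>vgroup \<G> v\<^esub>]"
      using gog_relation.vertex_mult[OF v V.inv_closed[OF g] g] g VLetter
      by (auto dest: gog_cong.base)
    moreover have "gog_cong \<G> T [VLetter v \<one>\<^bsub>vgroup \<G> v\<^esub>] []"
      by (intro gog_cong.base gog_relation.vertex_one v)
    ultimately have "gog_cong \<G> T [VLetter v (inv\<^bsub>vgroup \<G> v\<^esub> g), a] []"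
      by (rule gog_cong.trans)
    moreover have "[VLetter v (inv\<^bsub>vgroup \<G> v\<^esub> g)] \<in> gog_words \<G>"
      using v g by (simp add: gog_words_def)
    ultimately show ?thesis by blast
  next
    case (ELetter e)
    with that have e: "e \<in> arcs (base \<G>)" by (auto simp: gog_words_def)
    have "gog_cong \<G> T [ELetter (brev \<G> e), a] []"
      using gog_relation.edge_inverse[of "brev \<G> e" \<G> T] e ELetter by (auto intro: gog_cong.base)
    moreover have "[ELetter (brev \<G> e)] \<in> gog_words \<G>"
      using e by (simp add: gog_words_def)
    ultimately show ?thesis by blast
  qed
  have "\<exists>w\<in>gog_words \<G>. gog_cong \<G> T (w @ u) []" if "u \<in> gog_words \<G>" for u
    using that
  proof (induction u)
    case Nil
    show ?case by (auto simp: gog_words_def intro: gog_cong.refl bexI[of _ "[]"])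
  next
    case (Cons a u)
    then have "[a] \<in> gog_words \<G>" "u \<in> gog_words \<G>" by (auto simp: gog_words_def)
    then obtain b w where b: "[b] \<in> gog_words \<G>" "gog_cong \<G> T [b, a] []"
      and w: "w \<in> gog_words \<G>" "gog_cong \<G> T (w @ u) []"
      using letter_inv Cons.IH by blast
    have "gog_cong \<G> T (w @ [b, a] @ u) (w @ [] @ u)"
      by (intro gog_cong.append gog_cong.refl b(2))
    then have "gog_cong \<G> T ((w @ [b]) @ a # u) []"
      using w(2) by (auto intro: gog_cong.trans)
    moreover have "w @ [b] \<in> gog_words \<G>" using b(1) w(1) by (auto simp: gog_words_def)
    ultimately show ?case by blast
  qed
  then show "\<exists>y\<in>carrier ?F. y \<otimes>\<^bsub>?F\<^esub> x = \<one>\<^bsub>?F\<^esub>" if "x \<in> carrier ?F" for x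
    using that unfolding carr one by (fastforce simp: fundamental_group_mult gog_class_eq_iff)
qed


section \<open>Labelled graphs and generalized Baumslag--Solitar groups\<close>

locale labelled_graph = bidirected_digraph \<Gamma> arev + fin_digraph \<Gamma>
  for \<Gamma> :: "('v, 'e) pre_digraph" and arev :: "'e \<Rightarrow> 'e" +
  fixes lab :: "'e \<Rightarrow> int"
  assumes lab_nonzero: "e \<in> arcs \<Gamma> \<Longrightarrow> lab e \<noteq> 0"

definition gbs_graph_of_groups ::
  "('v, 'e) pre_digraph \<Rightarrow> ('e \<Rightarrow> 'e) \<Rightarrow> ('e \<Rightarrow> int) \<Rightarrow> ('v, 'e, int, int) graph_of_groups" where
  "gbs_graph_of_groups \<Gamma> arev lab =
     \<lparr>base = \<Gamma>, brev = arev, vgroup = (\<lambda>v. integer_group), egroup = (\<lambda>e. integer_group),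
      incl = (\<lambda>e n. lab e * n)\<rparr>"

lemma (in labelled_graph) graph_of_groups_gbs:
  "graph_of_groups (gbs_graph_of_groups \<Gamma> arev lab)"
  using bidirected_digraph lab_nonzero
  by (auto simp: graph_of_groups_def graph_of_groups_axioms_def gbs_graph_of_groups_def
      mon_def hom_def inj_on_def integer_group_def distrib_left
      intro: group_integer_group[unfolded integer_group_def])

text \<open>
  The fundamental group does not depend on the maximal subtree up to isomorphism;
  a connected graph has at least one.
\<close>

definition represented_by ::
  "('a, 'b) monoid_scheme \<Rightarrow> ('v, 'e) pre_digraph \<Rightarrow> ('e \<Rightarrow> 'e) \<Rightarrow> ('e \<Rightarrow> int) \<Rightarrow> bool" where
  "represented_by G \<Gamma> arev lab \<longleftrightarrow>
     (\<exists>T. maximal_subtree T \<Gamma> arev \<and>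
          G \<cong> fundamental_group (gbs_graph_of_groups \<Gamma> arev lab) T)"


section \<open>Rank, first Betti number and plateaus\<close>

definition group_rank :: "('a, 'b) monoid_scheme \<Rightarrow> enat" where
  "group_rank G =
     (INF S \<in> {S. S \<subseteq> carrier G \<and> generate G S = carrier G}.
        if finite S then enat (card S) else \<infinity>)"

text \<open>
  The first Betti number is the dimension of \<open>H\<^sub>1(\<Gamma>; \<rat>)\<close>, that is, of the kernel of the boundary map
  from 1-chains to 0-chains, as there are no 2-cells. A 1-chain is an antisymmetric function
  on the oriented edges; the coefficient of its boundary at \<open>v\<close> is
  minus the sum of its values over the edges with origin \<open>v\<close>.
\<close>

definition one_cycles :: "('v, 'e) pre_digraph \<Rightarrow> ('e \<Rightarrow> 'e) \<Rightarrow> ('e \<Rightarrow> rat) set" where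
  "one_cycles \<Gamma> arev =
     {f. (\<forall>e. e \<notin> arcs \<Gamma> \<longrightarrow> f e = 0) \<and>
         (\<forall>e\<in>arcs \<Gamma>. f (arev e) = - f e) \<and>
         (\<forall>v\<in>verts \<Gamma>. (\<Sum>e\<in>out_arcs \<Gamma> v. f e) = 0)}"

definition fun_scale :: "rat \<Rightarrow> ('e \<Rightarrow> rat) \<Rightarrow> 'e \<Rightarrow> rat" where
  "fun_scale c f = (\<lambda>e. c * f e)"

interpretation fun_vector_space: vector_space "fun_scale :: rat \<Rightarrow> ('e \<Rightarrow> rat) \<Rightarrow> 'e \<Rightarrow> rat"
  by unfold_locales (auto simp: fun_scale_def fun_eq_iff algebra_simps)

definition betti_number :: "('v, 'e) pre_digraph \<Rightarrow> ('e \<Rightarrow> 'e) \<Rightarrow> nat" where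
  "betti_number \<Gamma> arev = fun_vector_space.dim (one_cycles \<Gamma> arev)"

definition p_plateau ::
  "nat \<Rightarrow> ('v, 'e) pre_digraph \<Rightarrow> ('v, 'e) pre_digraph \<Rightarrow> ('e \<Rightarrow> 'e) \<Rightarrow> ('e \<Rightarrow> int) \<Rightarrow> bool" where
  "p_plateau p P \<Gamma> arev lab \<longleftrightarrow>
     serre_subgraph P \<Gamma> arev \<and> verts P \<noteq> {} \<and> connected P \<and>
     (\<forall>e\<in>arcs \<Gamma>. tail \<Gamma> e \<in> verts P \<longrightarrow> (int p dvd lab e \<longleftrightarrow> e \<notin> arcs P))"

definition plateau ::
  "('v, 'e) pre_digraph \<Rightarrow> ('v, 'e) pre_digraph \<Rightarrow> ('e \<Rightarrow> 'e) \<Rightarrow> ('e \<Rightarrow> int) \<Rightarrow> bool" where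
  "plateau P \<Gamma> arev lab \<longleftrightarrow> (\<exists>p. prime p \<and> p_plateau p P \<Gamma> arev lab)"

definition plateau_number :: "('v, 'e) pre_digraph \<Rightarrow> ('e \<Rightarrow> 'e) \<Rightarrow> ('e \<Rightarrow> int) \<Rightarrow> nat" where
  "plateau_number \<Gamma> arev lab =
     (LEAST n. \<exists>S \<subseteq> verts \<Gamma>. finite S \<and> card S = n \<and>
        (\<forall>P. plateau P \<Gamma> arev lab \<longrightarrow> S \<inter> verts P \<noteq> {}))"

end

theory Submission
  imports Defs "HOL-Library.Countable_Set"
begin

text \<open>
  Upper bound: let \<open>H\<close> be generated by all stable letters and by the vertex
  generators over a set \<open>S\<close> meeting all plateaus, and let the powers of the generator at \<open>v\<close> lying in
  \<open>H\<close> be the multiples of \<open>n v\<close>. If a prime \<open>p\<close> divided some \<open>n v\<close>, the vertices where \<open>n\<close> has the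
  largest exponent of \<open>p\<close> would contain a \<open>p\<close>-plateau, on which \<open>n \<noteq> 1\<close>; but \<open>n = 1\<close> on \<open>S\<close>.

  Lower bound: folding in the style of Stallings. Words for \<open>n\<close> generators are turned into a graph over
  \<open>\<Gamma>\<close>, with vertex groups generated by some elements, such that first Betti number plus number of
  elements is \<open>n\<close>. A fold that lowers the Betti number adds one element, so this sum never grows. A
  graph that admits no further fold is embedded into a set with an action of the whole group: a
  partial bijection between \<open>\<int>\<close>-sets extends once every orbit type is infinitely often available,
  which replaces normal forms in the fundamental group. As the generators fix the base point, so does
  the group; hence the folded graph is \<open>\<Gamma>\<close> with full vertex groups, and the given elements have to
  meet every plateau.
\<close>

section \<open>Actions of the integers\<close>

text \<open>The obstacle is that no normal form for elements of the fundamental group is at hand, so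
  a proper subgroup cannot be recognised by reading words. Therefore "the subgroup is everything" is
  encoded through actions, as \<open>rigid\<close>: every solution of the system in a set with an
  action consists of points fixed by the whole group. This property passes to any system that
  implies the old one, so a fold has only to be checked on solutions, and it is contradicted by
  exhibiting one action. The single countable type \<open>point\<close> carries all the actions
  used. Betti number and number of elements are never computed separately. With unknowns as vertices
  and equations as edges, where \<open>Eq v i k i\<close> counts as a loop, their sum is
  \<open>card C - card U + 1\<close> for a connected system, and the invariant kept by all moves is
  that this quantity is at most \<open>n\<close>.\<close>

lemma int_subgroup_multiples:
  fixes S :: "int set"
  assumes zero: "0 \<in> S" and add: "\<And>x y. x \<in> S \<Longrightarrow> y \<in> S \<Longrightarrow> x + y \<in> S"
    and neg: "\<And>x. x \<in> S \<Longrightarrow> - x \<in> S"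
  obtains d :: nat where "\<And>k. k \<in> S \<longleftrightarrow> int d dvd k"
proof (cases "S = {0}")
  case True
  show thesis using that[of 0] True by auto
next
  case False
  then obtain x where x: "x \<in> S" "x \<noteq> 0" using zero by auto
  have ex: "\<exists>d. 0 < d \<and> int d \<in> S"
    using x neg[of x] by (cases "x > 0") (auto intro: exI[of _ "nat x"] exI[of _ "nat (- x)"])
  define d where "d = (LEAST d. 0 < d \<and> int d \<in> S)"
  have d: "0 < d" "int d \<in> S" using LeastI_ex[OF ex] by (auto simp: d_def)
  have least: "d \<le> e" if "0 < e" "int e \<in> S" for e
    using that unfolding d_def by (blast intro: Least_le)
  have mult_nat: "int m * int d \<in> S" for m
    by (induction m) (auto simp: zero add d distrib_right)
  have mult: "q * int d \<in> S" for q
    using mult_nat[of "nat q"] neg[OF mult_nat[of "nat (- q)"]] by (cases "q \<ge> 0") auto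
  have "int d dvd k" if "k \<in> S" for k
  proof -
    have "k mod int d = k + (- (k div int d)) * int d"
      by (simp add: minus_div_mult_eq_mod[symmetric])
    then have "k mod int d \<in> S" using add[OF that mult] by metis
    moreover have "0 \<le> k mod int d" "k mod int d < int d" using d by auto
    ultimately have "k mod int d = 0"
      using least[of "nat (k mod int d)"] by (cases "k mod int d = 0") auto
    then show ?thesis by auto
  qed
  moreover have "k \<in> S" if "int d dvd k" for k
    using that mult by (auto simp: dvd_def mult.commute)
  ultimately show thesis using that by blast
qed

definition int_action :: "(int \<Rightarrow> 'x \<Rightarrow> 'x) \<Rightarrow> bool" where
  "int_action a \<longleftrightarrow> (\<forall>x. a 0 x = x) \<and> (\<forall>j k x. a (j + k) x = a j (a k x))"

lemma int_action_zero: "int_action a \<Longrightarrow> a 0 x = x"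
  and int_action_add: "int_action a \<Longrightarrow> a (j + k) x = a j (a k x)"
  by (simp_all add: int_action_def)

lemma int_action_eq_iff:
  assumes "int_action a"
  shows "a j x = a k y \<longleftrightarrow> a (j - k) x = y"
proof -
  have "a (- k) (a j x) = a (j - k) x" "a (- k) (a k y) = y" "a k (a (j - k) x) = a j x"
    using int_action_add[OF assms, of "- k" j x] int_action_add[OF assms, of "- k" k y]
      int_action_add[OF assms, of k "j - k" x] int_action_zero[OF assms] by (auto simp: algebra_simps)
  then show ?thesis by metis
qed

lemma int_action_scale: "int_action a \<Longrightarrow> int_action (\<lambda>k. a (l * k))"
  by (simp add: int_action_def distrib_left)

lemma int_action_bij: "int_action a \<Longrightarrow> bij (a k)"
proof (rule bijI)
  assume a: "int_action a"
  then show "inj (a k)" by (auto intro!: injI simp: int_action_eq_iff int_action_zero)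
  show "surj (a k)"
    using int_action_add[OF a, of k "- k"] int_action_zero[OF a] by (metis add.right_inverse surjI)
qed

definition orbit_of :: "(int \<Rightarrow> 'x \<Rightarrow> 'x) \<Rightarrow> 'x \<Rightarrow> 'x set" where
  "orbit_of a x = range (\<lambda>k. a k x)"

text \<open>The isomorphism type of the orbit of \<open>x\<close>: the integers modulo
  \<open>d\<close>, with \<open>d = 0\<close> for a free orbit.\<close>

definition stab_type :: "(int \<Rightarrow> 'x \<Rightarrow> 'x) \<Rightarrow> nat \<Rightarrow> 'x \<Rightarrow> bool" where
  "stab_type a d x \<longleftrightarrow> (\<forall>k. a k x = x \<longleftrightarrow> int d dvd k)"

lemma stab_type_exists:
  assumes "int_action a"
  shows "\<exists>d. stab_type a d x"
proof (rule int_subgroup_multiples[of "{k. a k x = x}"])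
  show "0 \<in> {k. a k x = x}" by (simp add: int_action_zero[OF assms])
  show "j + k \<in> {k. a k x = x}" if "j \<in> {k. a k x = x}" "k \<in> {k. a k x = x}" for j k
    using that by (simp add: int_action_add[OF assms])
  show "- k \<in> {k. a k x = x}" if "k \<in> {k. a k x = x}" for k
    using that int_action_eq_iff[OF assms, of 0 x k x] by (simp add: int_action_zero[OF assms])
qed (auto simp: stab_type_def)

lemma stab_type_unique: "stab_type a d x \<Longrightarrow> stab_type a e x \<Longrightarrow> d = e"
  unfolding stab_type_def by (metis dvd_antisym dvd_refl int_dvd_int_iff)

lemma stab_type_act:
  assumes a: "int_action a"
  shows "stab_type a d (a k x) \<longleftrightarrow> stab_type a d x"
proof -
  have "a j (a k x) = a k x \<longleftrightarrow> a j x = x" for j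
    using int_action_eq_iff[OF a, of "j + k" x k x] by (simp add: int_action_add[OF a])
  then show ?thesis by (simp add: stab_type_def)
qed

lemma stab_type_eq_iff:
  assumes "int_action a" "stab_type a d x"
  shows "a j x = a k x \<longleftrightarrow> int d dvd j - k"
  using assms by (simp add: int_action_eq_iff stab_type_def)

lemma self_in_orbit: "int_action a \<Longrightarrow> x \<in> orbit_of a x"
  unfolding orbit_of_def by (metis int_action_zero rangeI)

lemma orbit_of_act:
  assumes a: "int_action a"
  shows "orbit_of a (a k x) = orbit_of a x"
proof -
  have "a j (a k x) = a (j + k) x" "a j x = a (j - k) (a k x)" for j
    by (simp_all add: int_action_add[OF a, symmetric])
  then show ?thesis unfolding orbit_of_def by (metis (no_types, lifting) image_subset_iff
        range_subsetD rangeI subset_antisym)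
qed

lemma orbit_of_eqI: "int_action a \<Longrightarrow> y \<in> orbit_of a x \<Longrightarrow> orbit_of a y = orbit_of a x"
  using orbit_of_act[of a] by (metis orbit_of_def rangeE)

text \<open>All orbits are isomorphic to the integers modulo \<open>d\<close>: match the orbits by a
  bijection of countably infinite sets and send representative to representative. The coordinate
  relative to a representative is unique only modulo \<open>d\<close>, which is harmless because
  both sides have the same type.\<close>

lemma equivariant_bij_type:
  fixes a :: "int \<Rightarrow> 'x::countable \<Rightarrow> 'x" and b :: "int \<Rightarrow> 'y::countable \<Rightarrow> 'y"
  assumes a: "int_action a" and b: "int_action b"
    and A: "\<And>x k. x \<in> A \<Longrightarrow> a k x \<in> A" and B: "\<And>x k. x \<in> B \<Longrightarrow> b k x \<in> B"
    and typeA: "\<And>x. x \<in> A \<Longrightarrow> stab_type a d x" and typeB: "\<And>x. x \<in> B \<Longrightarrow> stab_type b d x"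
    and inf: "infinite (orbit_of a ` A)" "infinite (orbit_of b ` B)"
  shows "\<exists>f. bij_betw f A B \<and> (\<forall>x\<in>A. \<forall>k. f (a k x) = b k (f x))"
proof -
  have "countable (orbit_of a ` A)" "countable (orbit_of b ` B)" by auto
  then obtain g where g: "bij_betw g (orbit_of a ` A) (orbit_of b ` B)"
    using inf by (meson bij_betw_trans to_nat_on_infinite bij_betw_inv_into)
  define r where "r P = (SOME x. x \<in> P)" for P :: "'x set"
  define s where "s P = (SOME x. x \<in> P)" for P :: "'y set"
  define c where "c x = (SOME k. a k (r (orbit_of a x)) = x)" for x
  have r_in: "r (orbit_of a x) \<in> orbit_of a x" for x
    unfolding r_def using self_in_orbit[OF a] by (rule someI)
  have s_in: "s (orbit_of b x) \<in> orbit_of b x" for x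
    unfolding s_def using self_in_orbit[OF b] by (rule someI)
  have orb_r: "orbit_of a (r (orbit_of a x)) = orbit_of a x" for x
    by (rule orbit_of_eqI[OF a r_in])
  have orb_s: "orbit_of b (s (orbit_of b x)) = orbit_of b x" for x
    by (rule orbit_of_eqI[OF b s_in])
  have c: "a (c x) (r (orbit_of a x)) = x" for x
  proof -
    have "x \<in> orbit_of a (r (orbit_of a x))" using self_in_orbit[OF a] orb_r by simp
    then have "\<exists>k. a k (r (orbit_of a x)) = x" unfolding orbit_of_def by (metis rangeE)
    then show ?thesis unfolding c_def by (rule someI_ex)
  qed
  have typer: "stab_type a d (r (orbit_of a x))" if "x \<in> A" for x
    using typeA[OF that] r_in[of x] stab_type_act[OF a] by (auto simp: orbit_of_def)
  have sB: "s (orbit_of b y) \<in> B" if "y \<in> B" for y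
    using s_in[of y] B[OF that] by (auto simp: orbit_of_def)
  have gA: "\<exists>y\<in>B. g (orbit_of a x) = orbit_of b y" if "x \<in> A" for x
    using bij_betwE[OF g] that by blast
  define f where "f x = b (c x) (s (g (orbit_of a x)))" for x
  have sgB: "s (g (orbit_of a x)) \<in> B" if "x \<in> A" for x
    using gA[OF that] sB by auto
  have orb_f: "orbit_of b (f x) = g (orbit_of a x)" if "x \<in> A" for x
    using gA[OF that] orb_s unfolding f_def by (auto simp: orbit_of_act[OF b])
  have "f (a k x) = b k (f x)" if x: "x \<in> A" for x k
  proof -
    let ?r = "r (orbit_of a x)"
    have "a (c (a k x)) ?r = a (k + c x) ?r"
      using c[of "a k x"] c[of x] by (simp add: orbit_of_act[OF a] int_action_add[OF a])
    then have "int d dvd c (a k x) - (k + c x)"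
      by (simp add: stab_type_eq_iff[OF a typer[OF x]])
    then have "b (c (a k x)) (s (g (orbit_of a x))) = b (k + c x) (s (g (orbit_of a x)))"
      by (simp add: stab_type_eq_iff[OF b typeB[OF sgB[OF x]]])
    then show ?thesis by (simp add: f_def orbit_of_act[OF a] int_action_add[OF b])
  qed
  moreover have "inj_on f A"
  proof (rule inj_onI)
    fix x y assume x: "x \<in> A" and y: "y \<in> A" and eq: "f x = f y"
    then have "g (orbit_of a x) = g (orbit_of a y)" using orb_f by metis
    then have o: "orbit_of a x = orbit_of a y"
      using inj_onD[OF bij_betw_imp_inj_on[OF g]] x y by blast
    then have "b (c x) (s (g (orbit_of a x))) = b (c y) (s (g (orbit_of a x)))"
      using eq by (simp add: f_def)
    then have "int d dvd c x - c y"
      by (simp add: stab_type_eq_iff[OF b typeB[OF sgB[OF x]]])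
    then have "a (c x) (r (orbit_of a x)) = a (c y) (r (orbit_of a x))"
      by (simp add: stab_type_eq_iff[OF a typer[OF x]])
    then show "x = y" using c[of x] c[of y] o by metis
  qed
  moreover have "f ` A = B"
  proof safe
    fix x assume "x \<in> A"
    then show "f x \<in> B" unfolding f_def by (intro B sgB)
  next
    fix y assume y: "y \<in> B"
    then have "orbit_of b y \<in> g ` orbit_of a ` A" using g unfolding bij_betw_def by blast
    then obtain x where x: "x \<in> A" "g (orbit_of a x) = orbit_of b y" by auto
    have "y \<in> orbit_of b (s (orbit_of b y))" using orb_s self_in_orbit[OF b] by simp
    then obtain k where k: "y = b k (s (orbit_of b y))" by (auto simp: orbit_of_def)
    let ?z = "a k (r (orbit_of a x))"
    have z: "?z \<in> A" using A r_in[of x] x(1) by (auto simp: orbit_of_def)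
    have oz: "orbit_of a ?z = orbit_of a x" by (simp add: orbit_of_act[OF a] orb_r)
    have "a (c ?z) (r (orbit_of a x)) = a k (r (orbit_of a x))" using c[of ?z] oz by simp
    then have "int d dvd c ?z - k" by (simp add: stab_type_eq_iff[OF a typer[OF x(1)]])
    then have "b (c ?z) (s (orbit_of b y)) = b k (s (orbit_of b y))"
      by (simp add: stab_type_eq_iff[OF b typeB[OF sB[OF y]]])
    then have "f ?z = y" using oz x(2) k by (simp add: f_def)
    then show "y \<in> f ` A" using z by blast
  qed
  ultimately show ?thesis by (auto simp: bij_betw_def)
qed

text \<open>The points of type \<open>d\<close>, for varying \<open>d\<close>, partition both sets,
  so the bijections for the single types can be glued; uniqueness of the type gives injectivity
  across types.\<close>

lemma equivariant_bij:
  fixes a :: "int \<Rightarrow> 'x::countable \<Rightarrow> 'x" and b :: "int \<Rightarrow> 'y::countable \<Rightarrow> 'y"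
  assumes a: "int_action a" and b: "int_action b"
    and A: "\<And>x k. x \<in> A \<Longrightarrow> a k x \<in> A" and B: "\<And>x k. x \<in> B \<Longrightarrow> b k x \<in> B"
    and inf: "\<And>d. infinite (orbit_of a ` {x\<in>A. stab_type a d x})"
      "\<And>d. infinite (orbit_of b ` {x\<in>B. stab_type b d x})"
  obtains f where "bij_betw f A B" "\<And>x k. x \<in> A \<Longrightarrow> f (a k x) = b k (f x)"
proof -
  have "\<exists>f. bij_betw f {x\<in>A. stab_type a d x} {x\<in>B. stab_type b d x} \<and>
      (\<forall>x\<in>{x\<in>A. stab_type a d x}. \<forall>k. f (a k x) = b k (f x))" for d
    by (rule equivariant_bij_type[where d=d])
      (use a b A B inf in \<open>auto simp: stab_type_act\<close>)
  then obtain f where f: "\<And>d. bij_betw (f d) {x\<in>A. stab_type a d x} {x\<in>B. stab_type b d x}"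
    and eqv: "\<And>d x k. x \<in> A \<Longrightarrow> stab_type a d x \<Longrightarrow> f d (a k x) = b k (f d x)"
    by (simp add: choice_iff) metis
  define t where "t x = (SOME d. stab_type a d x)" for x
  have t: "stab_type a (t x) x" for x
    unfolding t_def using stab_type_exists[OF a] by (rule someI_ex)
  have t_eq: "t x = d" if "stab_type a d x" for x d
    using stab_type_unique[OF t that] .
  have fB: "f (t x) x \<in> B" "stab_type b (t x) (f (t x) x)" if "x \<in> A" for x
    using bij_betwE[OF f[of "t x"]] that t by auto
  have "bij_betw (\<lambda>x. f (t x) x) A B"
    unfolding bij_betw_def
  proof (intro conjI inj_onI equalityI subsetI)
    fix x y assume x: "x \<in> A" and y: "y \<in> A" and eq: "f (t x) x = f (t y) y"
    then have "t x = t y" using stab_type_unique fB(2)[OF x] fB(2)[OF y] by metis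
    then show "x = y"
      using inj_onD[OF bij_betw_imp_inj_on[OF f[of "t x"]], of x y] eq x y t[of x] t[of y] by simp
  next
    fix y assume "y \<in> (\<lambda>x. f (t x) x) ` A"
    then show "y \<in> B" using fB by auto
  next
    fix y assume y: "y \<in> B"
    obtain d where d: "stab_type b d y" using stab_type_exists[OF b] by blast
    then have "y \<in> f d ` {x\<in>A. stab_type a d x}"
      using y f[of d] unfolding bij_betw_def by blast
    then obtain x where "x \<in> A" "stab_type a d x" "f d x = y" by blast
    then show "y \<in> (\<lambda>x. f (t x) x) ` A" using t_eq by (auto simp: image_iff)
  qed
  moreover have "f (t (a k x)) (a k x) = b k (f (t x) x)" if "x \<in> A" for x k
    using that eqv t t_eq[of "t x" "a k x"] by (simp add: stab_type_act[OF a])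
  ultimately show thesis using that by blast
qed

text \<open>\<open>P\<close> is the graph of an equivariant partial bijection. Its domain and range
  are invariant, as a translation by \<open>k\<close> is undone by \<open>- k\<close>, so it is
  enough to match the two complements.\<close>

lemma extend_equivariant:
  fixes a b :: "int \<Rightarrow> 'x::countable \<Rightarrow> 'x"
  assumes a: "int_action a" and b: "int_action b"
    and closed: "\<And>x y k. (x, y) \<in> P \<Longrightarrow> (a k x, b k y) \<in> P"
    and functional: "single_valued P" and inj: "single_valued (P\<inverse>)"
    and inf: "\<And>d. infinite (orbit_of a ` {x\<in>- Domain P. stab_type a d x})"
      "\<And>d. infinite (orbit_of b ` {x\<in>- Range P. stab_type b d x})"
  obtains f where "bij f" "\<And>x k. f (a k x) = b k (f x)" "\<And>x y. (x, y) \<in> P \<Longrightarrow> f x = y"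
proof -
  have domain: "x \<in> Domain P" if "a k x \<in> Domain P" for k x
    using that closed[of "a k x" _ "- k"] int_action_add[OF a, of "- k" k x]
    by (auto simp: int_action_zero[OF a])
  have range: "y \<in> Range P" if "b k y \<in> Range P" for k y
    using that closed[of _ "b k y" "- k"] int_action_add[OF b, of "- k" k y]
    by (auto simp: int_action_zero[OF b])
  obtain g where g: "bij_betw g (- Domain P) (- Range P)"
    and geq: "\<And>x k. x \<in> - Domain P \<Longrightarrow> g (a k x) = b k (g x)"
    using equivariant_bij[OF a b, of "- Domain P" "- Range P"] inf domain range
    by (metis Compl_iff)
  define p where "p x = (SOME y. (x, y) \<in> P)" for x
  have p: "(x, p x) \<in> P" if "x \<in> Domain P" for x
    using that unfolding p_def by (auto intro: someI)
  have p_eq: "p x = y" if "(x, y) \<in> P" for x y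
    using p[of x] that functional by (auto dest: single_valuedD)
  have "bij_betw p (Domain P) (Range P)"
    unfolding bij_betw_def
  proof
    show "inj_on p (Domain P)"
    proof (rule inj_onI)
      fix x y assume "x \<in> Domain P" "y \<in> Domain P" "p x = p y"
      then have "(x, p x) \<in> P" "(y, p x) \<in> P" using p by metis+
      then show "x = y" using inj by (auto dest: single_valuedD)
    qed
    show "p ` Domain P = Range P"
      using p p_eq by (force simp: image_iff)
  qed
  define f where "f x = (if x \<in> Domain P then p x else g x)" for x
  have "bij_betw f (Domain P) (Range P)"
    using \<open>bij_betw p (Domain P) (Range P)\<close> by (rule bij_betw_cong[THEN iffD1, rotated]) (simp add: f_def)
  moreover have "bij_betw f (- Domain P) (- Range P)"
    using g by (rule bij_betw_cong[THEN iffD1, rotated]) (simp add: f_def)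
  ultimately have "bij_betw f (Domain P \<union> - Domain P) (Range P \<union> - Range P)"
    by (rule bij_betw_combine) auto
  then have "bij f" by simp
  moreover have "f (a k x) = b k (f x)" for x k
  proof (cases "x \<in> Domain P")
    case True
    then have "(a k x, b k (p x)) \<in> P" using closed p by blast
    then show ?thesis using True p_eq by (auto simp: f_def)
  next
    case False
    then show ?thesis using domain geq by (auto simp: f_def)
  qed
  moreover have "f x = y" if "(x, y) \<in> P" for x y
    using that p_eq by (auto simp: f_def)
  ultimately show thesis using that by blast
qed

section \<open>Systems of equations over a labelled graph\<close>

text \<open>
  A system of equations plays the part of a graph with a morphism to the labelled graph: the unknown
  \<open>(v, i)\<close> is a vertex over \<open>v\<close>, an \<open>Edge e\<close> equation is an edge over \<open>e\<close>, with exponents measuring its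
  position relative to the base points of the vertex groups, and \<open>Eq v i k i\<close> puts \<open>k\<close> into the group
  of \<open>(v, i)\<close>.
\<close>

type_synonym point = "nat \<times> nat \<times> int"

datatype ('v, 'e) equation =
  is_Eq: Eq 'v nat int nat
| Edge 'e nat int nat int

text \<open>Each geometric edge occurs with one orientation only; \<open>ls\<close> and
  \<open>lt\<close> are its labels near its two ends.\<close>

locale edge_labels =
  fixes V :: "'v set" and E :: "'e set" and src tgt :: "'e \<Rightarrow> 'v" and ls lt :: "'e \<Rightarrow> int"
  assumes src_V: "e \<in> E \<Longrightarrow> src e \<in> V" and tgt_V: "e \<in> E \<Longrightarrow> tgt e \<in> V"
    and ls_nonzero: "e \<in> E \<Longrightarrow> ls e \<noteq> 0" and lt_nonzero: "e \<in> E \<Longrightarrow> lt e \<noteq> 0"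
begin

text \<open>An action of the graph of groups: over each vertex a copy of \<open>point\<close> with
  an action of the vertex group, and \<open>\<tau> e\<close> from the copy over \<open>tgt e\<close>
  to the copy over \<open>src e\<close>. Equivariance of \<open>\<tau> e\<close> is the relation
  \<open>gog_relation.edge_conj\<close>.\<close>

definition gset :: "('v \<Rightarrow> int \<Rightarrow> point \<Rightarrow> point) \<Rightarrow> ('e \<Rightarrow> point \<Rightarrow> point) \<Rightarrow> bool" where
  "gset act \<tau> \<longleftrightarrow> (\<forall>v. int_action (act v)) \<and>
     (\<forall>e\<in>E. bij (\<tau> e) \<and>
        (\<forall>k x. \<tau> e (act (tgt e) (lt e * k) x) = act (src e) (ls e * k) (\<tau> e x)))"

fun sat :: "('v \<Rightarrow> int \<Rightarrow> point \<Rightarrow> point) \<Rightarrow> ('e \<Rightarrow> point \<Rightarrow> point) \<Rightarrow>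
    ('v \<times> nat \<Rightarrow> point) \<Rightarrow> ('v, 'e) equation \<Rightarrow> bool" where
  "sat act \<tau> h (Eq v i k j) \<longleftrightarrow> h (v, j) = act v k (h (v, i))"
| "sat act \<tau> h (Edge e i \<alpha> j \<beta>) \<longleftrightarrow>
     \<tau> e (act (tgt e) \<beta> (h (tgt e, j))) = act (src e) \<alpha> (h (src e, i))"

definition solution :: "('v \<Rightarrow> int \<Rightarrow> point \<Rightarrow> point) \<Rightarrow> ('e \<Rightarrow> point \<Rightarrow> point) \<Rightarrow>
    ('v \<times> nat \<Rightarrow> point) \<Rightarrow> ('v, 'e) equation set \<Rightarrow> bool" where
  "solution act \<tau> h C \<longleftrightarrow> gset act \<tau> \<and> (\<forall>c\<in>C. sat act \<tau> h c)"

fun over :: "('v \<times> nat) set \<Rightarrow> ('v, 'e) equation \<Rightarrow> bool" where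
  "over U (Eq v i k j) \<longleftrightarrow> (v, i) \<in> U \<and> (v, j) \<in> U"
| "over U (Edge e i \<alpha> j \<beta>) \<longleftrightarrow> e \<in> E \<and> (src e, i) \<in> U \<and> (tgt e, j) \<in> U"

definition rigid :: "('v \<times> nat) set \<Rightarrow> ('v, 'e) equation set \<Rightarrow> bool" where
  "rigid U C \<longleftrightarrow> (\<forall>act \<tau> h. solution act \<tau> h C \<longrightarrow>
     (\<exists>y. (\<forall>u\<in>U. h u = y (fst u)) \<and> (\<forall>v\<in>V. \<forall>k. act v k (y v) = y v) \<and>
       (\<forall>e\<in>E. \<tau> e (y (tgt e)) = y (src e))))"

definition rigid_system :: "nat \<Rightarrow> ('v \<times> nat) set \<Rightarrow> ('v, 'e) equation set \<Rightarrow> bool" where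
  "rigid_system n U C \<longleftrightarrow> finite U \<and> finite C \<and> fst ` U = V \<and> (\<forall>c\<in>C. over U c) \<and>
     rigid U C \<and> card C + 1 \<le> card U + n"

text \<open>The measure that makes folding terminate: trading an \<open>Edge\<close> for an
  \<open>Eq\<close> lowers the first summand, eliminating an unknown lowers the second without
  raising the first.\<close>

definition complexity :: "('v \<times> nat) set \<Rightarrow> ('v, 'e) equation set \<Rightarrow> nat" where
  "complexity U C = card {c\<in>C. \<not> is_Eq c} + card U"

text \<open>The exponents that \<open>C\<close> forces to fix an unknown. Moving along an equation
  ignores its shifts, since the integers are abelian and all points of an orbit have the same
  stabilizer.\<close>

inductive stab :: "('v, 'e) equation set \<Rightarrow> 'v \<times> nat \<Rightarrow> int \<Rightarrow> bool" for C where
  zero: "stab C u 0"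
| add: "stab C u k \<Longrightarrow> stab C u m \<Longrightarrow> stab C u (k + m)"
| neg: "stab C u k \<Longrightarrow> stab C u (- k)"
| self: "Eq v i k i \<in> C \<Longrightarrow> stab C (v, i) k"
| eq_forward: "Eq v i k j \<in> C \<Longrightarrow> stab C (v, i) m \<Longrightarrow> stab C (v, j) m"
| eq_backward: "Eq v i k j \<in> C \<Longrightarrow> stab C (v, j) m \<Longrightarrow> stab C (v, i) m"
| edge_forward: "Edge e i \<alpha> j \<beta> \<in> C \<Longrightarrow> e \<in> E \<Longrightarrow> stab C (tgt e, j) (lt e * m) \<Longrightarrow>
    stab C (src e, i) (ls e * m)"
| edge_backward: "Edge e i \<alpha> j \<beta> \<in> C \<Longrightarrow> e \<in> E \<Longrightarrow> stab C (src e, i) (ls e * m) \<Longrightarrow>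
    stab C (tgt e, j) (lt e * m)"

lemma gset_action: "gset act \<tau> \<Longrightarrow> int_action (act v)"
  by (simp add: gset_def)

lemma gset_eqv: "gset act \<tau> \<Longrightarrow> e \<in> E \<Longrightarrow>
    \<tau> e (act (tgt e) (lt e * k) x) = act (src e) (ls e * k) (\<tau> e x)"
  unfolding gset_def by blast

lemma gset_inj: "gset act \<tau> \<Longrightarrow> e \<in> E \<Longrightarrow> \<tau> e x = \<tau> e y \<longleftrightarrow> x = y"
  by (auto simp: gset_def bij_def dest: injD)

lemma act_comm: "gset act \<tau> \<Longrightarrow> act v j (act v k x) = act v k (act v j x)"
  using int_action_add[OF gset_action] by (metis add.commute)

lemma act_inj: "gset act \<tau> \<Longrightarrow> act v k x = act v k y \<longleftrightarrow> x = y"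
  using int_action_bij[OF gset_action] by (metis bij_is_inj injD)

lemma stab_sound:
  assumes sol: "solution act \<tau> h C" and "stab C u m"
  shows "act (fst u) m (h u) = h u"
proof -
  have g: "gset act \<tau>" using sol by (simp add: solution_def)
  note ia = gset_action[OF g]
  have shift: "act v m (act v k x) = act v k x \<longleftrightarrow> act v m x = x" for v m k x
    using act_comm[OF g, of v m k x] act_inj[OF g] by metis
  have edge: "act (tgt e) (lt e * m) (h (tgt e, j)) = h (tgt e, j) \<longleftrightarrow>
      act (src e) (ls e * m) (h (src e, i)) = h (src e, i)"
    if "Edge e i \<alpha> j \<beta> \<in> C" "e \<in> E" for e i \<alpha> j \<beta> m
  proof -
    let ?x = "h (tgt e, j)" and ?y = "h (src e, i)"
    have eq: "\<tau> e (act (tgt e) \<beta> ?x) = act (src e) \<alpha> ?y"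
      using sol that by (auto simp: solution_def)
    have "act (src e) (ls e * m) (act (src e) \<alpha> ?y) = \<tau> e (act (tgt e) (lt e * m) (act (tgt e) \<beta> ?x))"
      by (simp add: gset_eqv[OF g that(2)] eq)
    then have "act (src e) (ls e * m) (act (src e) \<alpha> ?y) = act (src e) \<alpha> ?y \<longleftrightarrow>
        act (tgt e) (lt e * m) (act (tgt e) \<beta> ?x) = act (tgt e) \<beta> ?x"
      using eq gset_inj[OF g that(2)] by metis
    then show ?thesis by (simp add: shift)
  qed
  have eq: "h (v, j) = act v k (h (v, i))" if "Eq v i k j \<in> C" for v i k j
    using sol that by (auto simp: solution_def)
  from \<open>stab C u m\<close> show ?thesis
  proof induction
    case (neg u k)
    then show ?case
      using int_action_eq_iff[OF ia, of "fst u" 0 "h u" k "h u"] by (simp add: int_action_zero[OF ia])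
  next
    case (self v i k)
    then show ?case using eq[of v i k i] by simp
  next
    case (eq_forward v i k j m)
    then show ?case using eq[of v i k j] by (simp add: shift)
  next
    case (eq_backward v i k j m)
    then show ?case using eq[of v i k j] by (simp add: shift)
  qed (auto simp: int_action_zero[OF ia] int_action_add[OF ia] edge)
qed

lemma rigidE:
  assumes "rigid U C" "solution act \<tau> h C"
  obtains y where "\<And>u. u \<in> U \<Longrightarrow> h u = y (fst u)" "\<And>v k. v \<in> V \<Longrightarrow> act v k (y v) = y v"
    "\<And>e. e \<in> E \<Longrightarrow> \<tau> e (y (tgt e)) = y (src e)"
  using assms unfolding rigid_def by blast

section \<open>Folding moves and elimination of unknowns\<close>

lemma complexity_replace:
  assumes "finite C" "Edge e i \<alpha> j \<beta> \<in> C"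
  shows "complexity U (insert (Eq v i' k j') (C - {Edge e i \<alpha> j \<beta>})) < complexity U C"
    and "card (insert (Eq v i' k j') (C - {Edge e i \<alpha> j \<beta>})) \<le> card C"
proof -
  let ?c = "Edge e i \<alpha> j \<beta>"
  have "{c\<in>insert (Eq v i' k j') (C - {?c}). \<not> is_Eq c} = {c\<in>C. \<not> is_Eq c} - {?c}" by auto
  moreover have "card ({c\<in>C. \<not> is_Eq c} - {?c}) < card {c\<in>C. \<not> is_Eq c}"
    by (rule card_Diff1_less) (use assms in simp_all)
  ultimately show "complexity U (insert (Eq v i' k j') (C - {?c})) < complexity U C"
    by (simp only: complexity_def add_less_mono1)
  have "card (C - {?c}) < card C" using assms by (rule card_Diff1_less)
  then show "card (insert (Eq v i' k j') (C - {?c})) \<le> card C"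
    using assms(1) by (simp add: card_insert_if)
qed

text \<open>The new system implies the old one, so it has no further solutions and inherits
  rigidity; the number of equations does not grow, so \<open>n\<close> is kept.\<close>

lemma replace_rigid_system:
  assumes sys: "rigid_system n U C" and c: "Edge e i \<alpha> j \<beta> \<in> C"
    and over: "(v, i') \<in> U" "(v, j') \<in> U"
    and imp: "\<And>act \<tau> h. solution act \<tau> h (insert (Eq v i' k j') (C - {Edge e i \<alpha> j \<beta>})) \<Longrightarrow>
      sat act \<tau> h (Edge e i \<alpha> j \<beta>)"
  shows "rigid_system n U (insert (Eq v i' k j') (C - {Edge e i \<alpha> j \<beta>}))"
proof -
  let ?C = "insert (Eq v i' k j') (C - {Edge e i \<alpha> j \<beta>})"
  have "solution act \<tau> h C" if "solution act \<tau> h ?C" for act \<tau> h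
    using that imp[OF that] by (auto simp: solution_def)
  then have "rigid U ?C" using sys unfolding rigid_system_def rigid_def by blast
  moreover have "card ?C \<le> card C"
    using complexity_replace(2) c sys by (auto simp: rigid_system_def)
  ultimately show ?thesis using sys over by (auto simp: rigid_system_def)
qed

text \<open>Folding: if two \<open>Edge\<close> equations for \<open>e\<close> concern the same coset at one end, then the second one
  only relates the unknowns at the other end, and can be traded for an \<open>Eq\<close> equation.\<close>

lemma fold_target:
  assumes sys: "rigid_system n U C"
    and c: "Edge e i \<alpha> j \<beta> \<in> C" and c': "Edge e i' \<alpha>' j \<beta>' \<in> C"
    and ne: "(i, \<alpha>, \<beta>) \<noteq> (i', \<alpha>', \<beta>')"
    and st: "stab C (tgt e, j) (\<beta>' - \<beta> - lt e * k)"
  shows "\<exists>C'. rigid_system n U C' \<and> complexity U C' < complexity U C"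
proof -
  \<comment> \<open>At the target, \<open>\<beta>'\<close> agrees with
    \<open>\<beta> + lt e * k\<close> up to an element of the stabilizer. Carried across
    \<open>e\<close>, the multiple \<open>lt e * k\<close> becomes \<open>ls e * k\<close>, which
    gives the shift \<open>?q\<close> between the two unknowns at the source.\<close>
  let ?c = "Edge e i' \<alpha>' j \<beta>'" and ?q = "ls e * k + \<alpha> - \<alpha>'"
  let ?C = "insert (Eq (src e) i ?q i') (C - {?c})"
  have e: "e \<in> E" and U: "(src e, i) \<in> U" "(src e, i') \<in> U"
    using sys c c' by (auto simp: rigid_system_def)
  have c1: "Edge e i \<alpha> j \<beta> \<in> ?C" and q: "Eq (src e) i ?q i' \<in> ?C" using c ne by auto
  \<comment> \<open>Soundness is wanted for solutions of \<open>?C\<close>, while \<open>st\<close>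
    may have been derived with the help of the discarded equation. Each such use is rerouted through
    the retained equation and the new \<open>Eq\<close>.\<close>
  have stab_mono: "stab ?C u m" if "stab C u m" for u m
    using that
  proof induction
    case (edge_forward f x a y b m)
    show ?case
    proof (cases "Edge f x a y b = ?c")
      case True
      then have "stab ?C (src e, i) (ls e * m)"
        using stab.edge_forward[OF c1 e] edge_forward by auto
      then show ?thesis using True stab.eq_forward[OF q] by auto
    next
      case False
      then show ?thesis using edge_forward by (auto intro: stab.edge_forward)
    qed
  next
    case (edge_backward f x a y b m)
    show ?case
    proof (cases "Edge f x a y b = ?c")
      case True
      then have "stab ?C (src e, i) (ls e * m)"
        using stab.eq_backward[OF q] edge_backward by auto
      then show ?thesis using True stab.edge_backward[OF c1 e] by auto
    next
      case False
      then show ?thesis using edge_backward by (auto intro: stab.edge_backward)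
    qed
  qed (auto intro: stab.intros)
  have "rigid_system n U ?C"
  proof (rule replace_rigid_system[OF sys c' U])
    fix act \<tau> h assume sol: "solution act \<tau> h ?C"
    then have g: "gset act \<tau>" by (simp add: solution_def)
    note [simp] = int_action_add[OF gset_action[OF g], symmetric]
    let ?x = "h (tgt e, j)"
    have "sat act \<tau> h (Edge e i \<alpha> j \<beta>)"
      using sol c1 unfolding solution_def by blast
    then have h1: "\<tau> e (act (tgt e) \<beta> ?x) = act (src e) \<alpha> (h (src e, i))" by simp
    have h2: "h (src e, i') = act (src e) ?q (h (src e, i))"
      using sol by (auto simp: solution_def)
    have "act (tgt e) (\<beta>' - \<beta> - lt e * k) ?x = ?x"
      using stab_sound[OF sol stab_mono[OF st]] by simp
    then have "act (tgt e) \<beta>' ?x = act (tgt e) (\<beta> + lt e * k) ?x"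
      by (simp add: int_action_eq_iff[OF gset_action[OF g]] diff_diff_eq)
    then have "\<tau> e (act (tgt e) \<beta>' ?x) = \<tau> e (act (tgt e) (lt e * k) (act (tgt e) \<beta> ?x))"
      by (simp add: add.commute)
    also have "\<dots> = act (src e) (ls e * k) (act (src e) \<alpha> (h (src e, i)))"
      by (simp only: gset_eqv[OF g e] h1)
    also have "\<dots> = act (src e) \<alpha>' (h (src e, i'))"
      by (simp add: h2 algebra_simps)
    finally show "sat act \<tau> h ?c" by simp
  qed
  moreover have "complexity U ?C < complexity U C"
    using complexity_replace(1) c' sys by (auto simp: rigid_system_def)
  ultimately show ?thesis by blast
qed

lemma fold_source:
  assumes sys: "rigid_system n U C"
    and c: "Edge e i \<alpha> j \<beta> \<in> C" and c': "Edge e i \<alpha>' j' \<beta>' \<in> C"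
    and ne: "(\<alpha>, j, \<beta>) \<noteq> (\<alpha>', j', \<beta>')"
    and st: "stab C (src e, i) (\<alpha>' - \<alpha> - ls e * k)"
  shows "\<exists>C'. rigid_system n U C' \<and> complexity U C' < complexity U C"
proof -
  let ?c = "Edge e i \<alpha>' j' \<beta>'" and ?q = "lt e * k + \<beta> - \<beta>'"
  let ?C = "insert (Eq (tgt e) j ?q j') (C - {?c})"
  have e: "e \<in> E" and U: "(tgt e, j) \<in> U" "(tgt e, j') \<in> U"
    using sys c c' by (auto simp: rigid_system_def)
  have c1: "Edge e i \<alpha> j \<beta> \<in> ?C" and q: "Eq (tgt e) j ?q j' \<in> ?C" using c ne by auto
  have stab_mono: "stab ?C u m" if "stab C u m" for u m
    using that
  proof induction
    case (edge_forward f x a y b m)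
    show ?case
    proof (cases "Edge f x a y b = ?c")
      case True
      then have "stab ?C (tgt e, j) (lt e * m)"
        using stab.eq_backward[OF q] edge_forward by auto
      then show ?thesis using True stab.edge_forward[OF c1 e] by auto
    next
      case False
      then show ?thesis using edge_forward by (auto intro: stab.edge_forward)
    qed
  next
    case (edge_backward f x a y b m)
    show ?case
    proof (cases "Edge f x a y b = ?c")
      case True
      then have "stab ?C (tgt e, j) (lt e * m)"
        using stab.edge_backward[OF c1 e] edge_backward by auto
      then show ?thesis using True stab.eq_forward[OF q] by auto
    next
      case False
      then show ?thesis using edge_backward by (auto intro: stab.edge_backward)
    qed
  qed (auto intro: stab.intros)
  have "rigid_system n U ?C"
  proof (rule replace_rigid_system[OF sys c' U])
    fix act \<tau> h assume sol: "solution act \<tau> h ?C"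
    then have g: "gset act \<tau>" by (simp add: solution_def)
    note [simp] = int_action_add[OF gset_action[OF g], symmetric]
    let ?x = "h (tgt e, j)"
    have "sat act \<tau> h (Edge e i \<alpha> j \<beta>)"
      using sol c1 unfolding solution_def by blast
    then have h1: "\<tau> e (act (tgt e) \<beta> ?x) = act (src e) \<alpha> (h (src e, i))" by simp
    have h2: "h (tgt e, j') = act (tgt e) ?q ?x"
      using sol by (auto simp: solution_def)
    have "act (src e) (\<alpha>' - \<alpha> - ls e * k) (h (src e, i)) = h (src e, i)"
      using stab_sound[OF sol stab_mono[OF st]] by simp
    then have "act (src e) \<alpha>' (h (src e, i)) = act (src e) (\<alpha> + ls e * k) (h (src e, i))"
      by (simp add: int_action_eq_iff[OF gset_action[OF g]] diff_diff_eq)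
    then have "act (src e) \<alpha>' (h (src e, i)) = act (src e) (ls e * k) (act (src e) \<alpha> (h (src e, i)))"
      by (simp add: add.commute)
    also have "\<dots> = \<tau> e (act (tgt e) (lt e * k) (act (tgt e) \<beta> ?x))"
      by (simp only: gset_eqv[OF g e] h1)
    also have "\<dots> = \<tau> e (act (tgt e) \<beta>' (h (tgt e, j')))"
      by (simp add: h2 algebra_simps)
    finally show "sat act \<tau> h ?c" by simp
  qed
  moreover have "complexity U ?C < complexity U C"
    using complexity_replace(1) c' sys by (auto simp: rigid_system_def)
  ultimately show ?thesis by blast
qed

text \<open>A change of unknowns: \<open>u\<close> becomes the translate by \<open>d u\<close> of
  the unknown with number \<open>r u\<close> over the same vertex.\<close>

fun subst :: "('v \<times> nat \<Rightarrow> nat) \<Rightarrow> ('v \<times> nat \<Rightarrow> int) \<Rightarrow> ('v, 'e) equation \<Rightarrow> ('v, 'e) equation" where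
  "subst r d (Eq v i k j) = Eq v (r (v, i)) (k + d (v, i) - d (v, j)) (r (v, j))"
| "subst r d (Edge e i \<alpha> j \<beta>) =
     Edge e (r (src e, i)) (\<alpha> + d (src e, i)) (r (tgt e, j)) (\<beta> + d (tgt e, j))"

lemma sat_subst:
  assumes "gset act \<tau>"
  shows "sat act \<tau> h (subst r d c) \<longleftrightarrow>
    sat act \<tau> (\<lambda>u. act (fst u) (d u) (h (fst u, r u))) c"
proof (cases c)
  case (Eq v i k j)
  note ia = gset_action[OF assms]
  have "h (v, r (v, j)) = act v (k + d (v, i) - d (v, j)) (h (v, r (v, i))) \<longleftrightarrow>
      act v (d (v, j)) (h (v, r (v, j))) = act v (k + d (v, i)) (h (v, r (v, i)))"
    using int_action_eq_iff[OF ia, of v "k + d (v, i)" "h (v, r (v, i))" "d (v, j)" "h (v, r (v, j))"]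
    by metis
  then show ?thesis by (simp add: Eq int_action_add[OF ia])
qed (simp add: int_action_add[OF gset_action[OF assms]])

text \<open>An \<open>Eq\<close> between different unknowns is solved for one of them. One equation
  and one unknown disappear together, so \<open>card C - card U\<close> does not grow; equations
  that coincide after the substitution only lower it.\<close>

lemma eliminate:
  assumes sys: "rigid_system n U C" and c: "Eq v i k j \<in> C" and ne: "i \<noteq> j"
  shows "\<exists>U' C'. rigid_system n U' C' \<and> complexity U' C' < complexity U C"
proof -
  define r where "r u = (if u = (v, j) then i else snd u)" for u
  define d where "d u = (if u = (v, j) then k else 0)" for u
  let ?U = "U - {(v, j)}" and ?C = "subst r d ` (C - {Eq v i k j})"
  have U: "(v, i) \<in> U" "(v, j) \<in> U" "finite U" and C: "finite C" "\<And>c. c \<in> C \<Longrightarrow> over U c"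
    and rig: "rigid U C"
    using sys c by (auto simp: rigid_system_def)
  have over_subst: "over ?U (subst r d c)" if "over U c" for c
    using that U ne by (cases c) (auto simp: r_def)
  have rU: "(fst u, r u) \<in> ?U" if "u \<in> U" for u
    using that U ne by (auto simp: r_def)
  have "rigid ?U ?C"
    unfolding rigid_def
  proof (intro allI impI)
    fix act \<tau> h assume sol: "solution act \<tau> h ?C"
    then have g: "gset act \<tau>" by (simp add: solution_def)
    let ?h = "\<lambda>u. act (fst u) (d u) (h (fst u, r u))"
    have h_eq: "?h u = h u" if "u \<noteq> (v, j)" for u
      using that by (simp add: r_def d_def int_action_zero[OF gset_action[OF g]])
    have "sat act \<tau> ?h c" if "c \<in> C" for c
    proof (cases "c = Eq v i k j")
      case True
      then show ?thesis using h_eq[of "(v, i)"] ne by (simp add: r_def d_def)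
    next
      case False
      then have "sat act \<tau> h (subst r d c)" using that sol by (simp add: solution_def)
      then show ?thesis by (simp add: sat_subst[OF g])
    qed
    then have "solution act \<tau> ?h C" using g by (simp add: solution_def)
    then obtain y where y: "\<forall>u\<in>U. ?h u = y (fst u)" "\<forall>v\<in>V. \<forall>k. act v k (y v) = y v"
      "\<forall>e\<in>E. \<tau> e (y (tgt e)) = y (src e)"
      using rig unfolding rigid_def by blast
    moreover have "\<forall>u\<in>?U. h u = y (fst u)" using y(1) h_eq by (metis Diff_iff singletonI)
    ultimately show "\<exists>y. (\<forall>u\<in>?U. h u = y (fst u)) \<and> (\<forall>v\<in>V. \<forall>k. act v k (y v) = y v) \<and>
        (\<forall>e\<in>E. \<tau> e (y (tgt e)) = y (src e))"
      by blast
  qed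
  moreover have "fst ` ?U = V"
  proof -
    have "v \<in> fst ` ?U" using U ne by (intro image_eqI[of _ _ "(v, i)"]) auto
    moreover have "fst ` U = insert v (fst ` ?U)" using U(2) by (metis fst_conv image_insert insert_Diff)
    ultimately have "fst ` ?U = fst ` U" by (simp add: insert_absorb)
    then show ?thesis using sys by (simp add: rigid_system_def)
  qed
  moreover have "card ?C + 1 \<le> card C"
  proof -
    have "card ?C \<le> card (C - {Eq v i k j})" by (rule card_image_le) (use C in simp)
    also have "\<dots> < card C" by (rule card_Diff1_less[OF C(1) c])
    finally show ?thesis by simp
  qed
  moreover have cardU: "card ?U + 1 = card U" using card_Suc_Diff1[OF U(3,2)] by simp
  ultimately have "rigid_system n ?U ?C"
    using sys over_subst by (auto simp: rigid_system_def)
  moreover have "complexity ?U ?C < complexity U C"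
  proof -
    have "{c\<in>?C. \<not> is_Eq c} \<subseteq> subst r d ` {c\<in>C. \<not> is_Eq c}"
    proof
      fix c assume "c \<in> {c\<in>?C. \<not> is_Eq c}"
      then obtain c' where "c' \<in> C" "c = subst r d c'" "\<not> is_Eq c" by auto
      moreover from this have "\<not> is_Eq c'" by (cases c') auto
      ultimately show "c \<in> subst r d ` {c\<in>C. \<not> is_Eq c}" by blast
    qed
    then have "card {c\<in>?C. \<not> is_Eq c} \<le> card (subst r d ` {c\<in>C. \<not> is_Eq c})"
      using C(1) by (intro card_mono) auto
    also have "\<dots> \<le> card {c\<in>C. \<not> is_Eq c}" using C(1) by (intro card_image_le) auto
    finally have "card {c\<in>?C. \<not> is_Eq c} \<le> card {c\<in>C. \<not> is_Eq c}" .
    then show ?thesis using cardU by (simp add: complexity_def)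
  qed
  ultimately show ?thesis by blast
qed

text \<open>No move applies: the remaining \<open>Eq\<close> equations are loops, and at each end of
  \<open>e\<close> every coset modulo the label and the derived stabilizer carries at most one
  \<open>Edge\<close> equation. This is the local injectivity of a folded graph.\<close>

definition folded :: "('v, 'e) equation set \<Rightarrow> bool" where
  "folded C \<longleftrightarrow> (\<forall>v i k j. Eq v i k j \<in> C \<longrightarrow> i = j) \<and>
     (\<forall>e i \<alpha> j \<beta> i' \<alpha>' \<beta>' k. Edge e i \<alpha> j \<beta> \<in> C \<longrightarrow> Edge e i' \<alpha>' j \<beta>' \<in> C \<longrightarrow>
        stab C (tgt e, j) (\<beta>' - \<beta> - lt e * k) \<longrightarrow> (i, \<alpha>, \<beta>) = (i', \<alpha>', \<beta>')) \<and>
     (\<forall>e i \<alpha> j \<beta> \<alpha>' j' \<beta>' k. Edge e i \<alpha> j \<beta> \<in> C \<longrightarrow> Edge e i \<alpha>' j' \<beta>' \<in> C \<longrightarrow>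
        stab C (src e, i) (\<alpha>' - \<alpha> - ls e * k) \<longrightarrow> (\<alpha>, j, \<beta>) = (\<alpha>', j', \<beta>'))"

lemma folded_Eq: "folded C \<Longrightarrow> Eq v i k j \<in> C \<Longrightarrow> i = j"
  unfolding folded_def by (elim conjE) metis

lemma folded_target:
  "folded C \<Longrightarrow> Edge e i \<alpha> j \<beta> \<in> C \<Longrightarrow> Edge e i' \<alpha>' j \<beta>' \<in> C \<Longrightarrow>
    stab C (tgt e, j) (\<beta>' - \<beta> - lt e * k) \<Longrightarrow> i = i' \<and> \<alpha> = \<alpha>' \<and> \<beta> = \<beta>'"
  unfolding folded_def by (elim conjE) (metis prod.inject)

lemma folded_source:
  "folded C \<Longrightarrow> Edge e i \<alpha> j \<beta> \<in> C \<Longrightarrow> Edge e i \<alpha>' j' \<beta>' \<in> C \<Longrightarrow>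
    stab C (src e, i) (\<alpha>' - \<alpha> - ls e * k) \<Longrightarrow> \<alpha> = \<alpha>' \<and> j = j' \<and> \<beta> = \<beta>'"
  unfolding folded_def by (elim conjE) (metis prod.inject)

text \<open>Every move lowers \<open>complexity\<close>, so a rigid system of least complexity is
  folded.\<close>

lemma folded_system_exists:
  assumes "rigid_system n U C"
  obtains U' C' where "rigid_system n U' C'" "folded C'"
proof -
  obtain U' C' where sys: "rigid_system n U' C'"
    and least: "\<And>U'' C''. rigid_system n U'' C'' \<Longrightarrow> complexity U' C' \<le> complexity U'' C''"
    using ex_has_least_nat[of "\<lambda>(U, C). rigid_system n U C" "(U, C)" "\<lambda>(U, C). complexity U C"] assms
    by auto
  have "folded C'"
    unfolding folded_def
    using least eliminate[OF sys] fold_target[OF sys] fold_source[OF sys]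
    by (intro conjI allI impI) (meson leD)+
  then show thesis using that sys by blast
qed

end

section \<open>Folded systems\<close>

text \<open>The point \<open>(c, d, m)\<close> lies on the \<open>c\<close>-th orbit isomorphic to the integers modulo \<open>d\<close>
  (the integers if \<open>d = 0\<close>, as then \<open>m mod d = m\<close>). Unreduced \<open>m\<close> give junk fixed points.\<close>

definition point_shift :: "int \<Rightarrow> point \<Rightarrow> point" where
  "point_shift k x = (case x of (c, d, m) \<Rightarrow>
     if m mod int d = m then (c, d, (m + k) mod int d) else (c, d, m))"

lemma int_action_point_shift: "int_action point_shift"
  by (auto simp: int_action_def point_shift_def mod_simps ac_simps split: prod.split)

lemma point_shift_base: "point_shift k (c, d, 0) = (c, d, k mod int d)"
  by (simp add: point_shift_def)

lemma point_shift_base_eq_iff: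
  "point_shift j (c, d, 0) = point_shift k (c, d, 0) \<longleftrightarrow> int d dvd j - k"
  by (simp add: point_shift_base mod_eq_dvd_iff)

lemma fst_point_shift: "fst (point_shift k x) = fst x"
  by (simp add: point_shift_def split: prod.split)

text \<open>The first coordinate of a point only numbers the orbits and is invariant, so the
  infinitely many values not met by \<open>D\<close> give distinct orbits outside
  \<open>D\<close>.\<close>

lemma infinite_orbits_point_shift:
  assumes l: "l \<noteq> 0" and D: "finite (fst ` D)"
  shows "infinite (orbit_of (\<lambda>k. point_shift (l * k)) `
    {x\<in>- D. stab_type (\<lambda>k. point_shift (l * k)) d x})"
proof -
  let ?a = "\<lambda>k. point_shift (l * k)"
  \<comment> \<open>When only multiples of \<open>l\<close> act, type \<open>d\<close> is found
    inside the integers modulo \<open>d * nat \<bar>l\<bar>\<close>, as this number divides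
    \<open>l * k\<close> exactly when \<open>d\<close> divides \<open>k\<close>.\<close>
  let ?x = "\<lambda>c. (c, d * nat \<bar>l\<bar>, 0)"
  have "int (d * nat \<bar>l\<bar>) dvd l * k \<longleftrightarrow> int d dvd k" for k
  proof -
    have "int (d * nat \<bar>l\<bar>) = \<bar>int d * l\<bar>" by (simp add: abs_mult)
    then show ?thesis using l by (simp add: mult.commute[of l])
  qed
  then have "stab_type ?a d (?x c)" for c
    unfolding stab_type_def by (simp add: point_shift_base mod_eq_0_iff_dvd del: of_nat_mult)
  then have sub: "?x ` (- fst ` D) \<subseteq> {x\<in>- D. stab_type ?a d x}"
    by force
  have fst_orbit: "fst ` orbit_of ?a x = {fst x}" for x
    by (auto simp: orbit_of_def fst_point_shift image_image)
  have "inj_on (orbit_of ?a) (?x ` (- fst ` D))"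
  proof (rule inj_onI)
    fix y z assume "y \<in> ?x ` (- fst ` D)" "z \<in> ?x ` (- fst ` D)" "orbit_of ?a y = orbit_of ?a z"
    moreover from this(3) have "fst y = fst z" by (metis fst_orbit the_elem_eq)
    ultimately show "y = z" by auto
  qed
  moreover have "infinite (?x ` (- fst ` D))"
    using D by (subst finite_image_iff) (auto simp: inj_on_def Compl_eq_Diff_UNIV)
  ultimately have "infinite (orbit_of ?a ` ?x ` (- fst ` D))"
    by (simp add: finite_image_iff)
  then show ?thesis using finite_subset[OF image_mono[OF sub]] by blast
qed

context edge_labels
begin

text \<open>The canonical solution: each unknown is the base point of its own orbit, whose type is
  given by the derived stabilizer. The \<open>Edge\<close> equations then prescribe
  \<open>\<tau> e\<close> on finitely many orbits, and foldedness makes this prescription a partial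
  bijection.\<close>

lemma folded_solution:
  assumes sys: "rigid_system n U C" and fold: "folded C"
  obtains act \<tau> h d where "solution act \<tau> h C"
    "\<And>v i. h (v, i) = (i, d (v, i), 0)" "\<And>u k. stab C u k \<longleftrightarrow> int (d u) dvd k"
    "\<And>v. act v = point_shift"
proof -
  have "\<exists>d. \<forall>k. stab C u k \<longleftrightarrow> int d dvd k" for u
    by (rule int_subgroup_multiples[of "{k. stab C u k}"]) (auto intro: stab.zero stab.add stab.neg)
  then obtain d where d: "\<And>u k. stab C u k \<longleftrightarrow> int (d u) dvd k" by metis
  define h where "h u = (snd u, d u, 0::int)" for u
  have h_eq: "point_shift j (h (v, i)) = point_shift k (h (v, i)) \<longleftrightarrow> stab C (v, i) (j - k)" for v i j k
    by (simp add: h_def point_shift_base_eq_iff d)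
  have h_fst: "point_shift j (h (v, i)) = point_shift k (h (v, i')) \<Longrightarrow> i = i'" for v i i' j k
    by (metis fst_conv fst_point_shift h_def snd_conv)
  have sat_Eq: "i = j \<and> stab C (v, i) k" if "Eq v i k j \<in> C" for v i k j
  proof -
    have "i = j" using folded_Eq[OF fold that] .
    then show ?thesis using that stab.self by blast
  qed
  have "\<exists>t. bij t \<and> (\<forall>k x. t (point_shift (lt e * k) x) = point_shift (ls e * k) (t x)) \<and>
      (\<forall>i \<alpha> j \<beta>. Edge e i \<alpha> j \<beta> \<in> C \<longrightarrow>
        t (point_shift \<beta> (h (tgt e, j))) = point_shift \<alpha> (h (src e, i)))"
    if e: "e \<in> E" for e
  proof -
    let ?a = "\<lambda>k. point_shift (lt e * k)" and ?b = "\<lambda>k. point_shift (ls e * k)"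
    \<comment> \<open>The prescribed pairs, closed under simultaneous translation by
      \<open>lt e * k\<close> and \<open>ls e * k\<close>.\<close>
    define P where "P = {(point_shift (lt e * k + \<beta>) (h (tgt e, j)),
        point_shift (ls e * k + \<alpha>) (h (src e, i))) | k i \<alpha> j \<beta>. Edge e i \<alpha> j \<beta> \<in> C}"
    have PI: "(point_shift (lt e * k + \<beta>) (h (tgt e, j)), point_shift (ls e * k + \<alpha>) (h (src e, i))) \<in> P"
      if "Edge e i \<alpha> j \<beta> \<in> C" for k i \<alpha> j \<beta>
      using that unfolding P_def by blast
    obtain t where t: "bij t" "\<And>x k. t (?a k x) = ?b k (t x)" "\<And>x y. (x, y) \<in> P \<Longrightarrow> t x = y"
    proof (rule extend_equivariant[of ?a ?b P])
      show "int_action ?a" "int_action ?b"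
        by (intro int_action_scale int_action_point_shift)+
      show "(?a k x, ?b k y) \<in> P" if "(x, y) \<in> P" for x y k
      proof -
        obtain k' i \<alpha> j \<beta> where c: "Edge e i \<alpha> j \<beta> \<in> C"
          "x = point_shift (lt e * k' + \<beta>) (h (tgt e, j))"
          "y = point_shift (ls e * k' + \<alpha>) (h (src e, i))"
          using \<open>(x, y) \<in> P\<close> by (auto simp: P_def)
        then show ?thesis
          using PI[OF c(1), of "k + k'"]
          by (simp add: int_action_add[OF int_action_point_shift, symmetric] distrib_left add.assoc)
      qed
      show "single_valued P"
      proof (rule single_valuedI)
        fix x y z assume "(x, y) \<in> P" "(x, z) \<in> P"
        then obtain k i \<alpha> j \<beta> k' i' \<alpha>' j' \<beta>' where
          c: "Edge e i \<alpha> j \<beta> \<in> C" "Edge e i' \<alpha>' j' \<beta>' \<in> C"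
          and x: "x = point_shift (lt e * k + \<beta>) (h (tgt e, j))"
            "x = point_shift (lt e * k' + \<beta>') (h (tgt e, j'))"
          and y: "y = point_shift (ls e * k + \<alpha>) (h (src e, i))"
            "z = point_shift (ls e * k' + \<alpha>') (h (src e, i'))"
          unfolding P_def by blast
        have j: "j' = j" using x h_fst by metis
        then have st: "stab C (tgt e, j) ((lt e * k' + \<beta>') - (lt e * k + \<beta>))"
          using x h_eq by metis
        \<comment> \<open>Equal points at the target put the two equations into one coset, so
          foldedness makes them the same equation. It remains that \<open>lt e * (k' - k)\<close>
          stabilizes the target, and \<open>edge_forward\<close> carries this to the source.\<close>
        then have "stab C (tgt e, j) (\<beta>' - \<beta> - lt e * (k - k'))" by (simp add: algebra_simps)
        then have same: "i' = i" "\<alpha>' = \<alpha>" "\<beta>' = \<beta>"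
          using folded_target[OF fold, of e i \<alpha> j \<beta> i' \<alpha>' \<beta>'] c j by blast+
        have "stab C (tgt e, j) (lt e * (k' - k))" using st same by (simp add: algebra_simps)
        then have "stab C (src e, i) (ls e * (k' - k))" by (rule stab.edge_forward[OF c(1) e])
        then show "y = z" using y same h_eq[of "ls e * k' + \<alpha>" "src e" i "ls e * k + \<alpha>"]
          by (simp add: algebra_simps)
      qed
      show "single_valued (P\<inverse>)"
      proof (rule single_valuedI)
        fix x y z assume "(x, y) \<in> P\<inverse>" "(x, z) \<in> P\<inverse>"
        then obtain k i \<alpha> j \<beta> k' i' \<alpha>' j' \<beta>' where
          c: "Edge e i \<alpha> j \<beta> \<in> C" "Edge e i' \<alpha>' j' \<beta>' \<in> C"
          and y: "y = point_shift (lt e * k + \<beta>) (h (tgt e, j))"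
            "z = point_shift (lt e * k' + \<beta>') (h (tgt e, j'))"
          and x: "x = point_shift (ls e * k + \<alpha>) (h (src e, i))"
            "x = point_shift (ls e * k' + \<alpha>') (h (src e, i'))"
          unfolding P_def by blast
        have i: "i' = i" using x h_fst by metis
        then have st: "stab C (src e, i) ((ls e * k' + \<alpha>') - (ls e * k + \<alpha>))"
          using x h_eq by metis
        then have "stab C (src e, i) (\<alpha>' - \<alpha> - ls e * (k - k'))" by (simp add: algebra_simps)
        then have same: "\<alpha>' = \<alpha>" "j' = j" "\<beta>' = \<beta>"
          using folded_source[OF fold, of e i \<alpha> j \<beta> \<alpha>' j' \<beta>'] c i by blast+
        have "stab C (src e, i) (ls e * (k' - k))" using st same by (simp add: algebra_simps)
        then have "stab C (tgt e, j) (lt e * (k' - k))" by (rule stab.edge_backward[OF c(1) e])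
        then show "y = z" using y same h_eq[of "lt e * k' + \<beta>" "tgt e" j "lt e * k + \<beta>"]
          by (simp add: algebra_simps)
      qed
      have over: "j \<in> snd ` U" "i \<in> snd ` U" if "Edge e i \<alpha> j \<beta> \<in> C" for i \<alpha> j \<beta>
      proof -
        have "over U (Edge e i \<alpha> j \<beta>)" using sys that unfolding rigid_system_def by blast
        then show "j \<in> snd ` U" "i \<in> snd ` U" by (auto intro: rev_image_eqI)
      qed
      have "fst ` Domain P \<subseteq> snd ` U" "fst ` Range P \<subseteq> snd ` U"
        by (auto simp: P_def fst_point_shift h_def dest: over)
      then have fin: "finite (fst ` Domain P)" "finite (fst ` Range P)"
        using sys by (metis finite_imageI finite_subset rigid_system_def)+
      show "infinite (orbit_of ?a ` {x\<in>- Domain P. stab_type ?a d x})" for d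
        by (rule infinite_orbits_point_shift[OF lt_nonzero[OF e] fin(1)])
      show "infinite (orbit_of ?b ` {x\<in>- Range P. stab_type ?b d x})" for d
        by (rule infinite_orbits_point_shift[OF ls_nonzero[OF e] fin(2)])
    qed (rule that)
    have "(point_shift \<beta> (h (tgt e, j)), point_shift \<alpha> (h (src e, i))) \<in> P"
      if "Edge e i \<alpha> j \<beta> \<in> C" for i \<alpha> j \<beta>
      using PI[OF that, of 0] by simp
    then show ?thesis using t by blast
  qed
  then obtain \<tau> where \<tau>: "\<And>e. e \<in> E \<Longrightarrow> bij (\<tau> e)"
    "\<And>e k x. e \<in> E \<Longrightarrow> \<tau> e (point_shift (lt e * k) x) = point_shift (ls e * k) (\<tau> e x)"
    "\<And>e i \<alpha> j \<beta>. e \<in> E \<Longrightarrow> Edge e i \<alpha> j \<beta> \<in> C \<Longrightarrow>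
      \<tau> e (point_shift \<beta> (h (tgt e, j))) = point_shift \<alpha> (h (src e, i))"
    by metis
  have "gset (\<lambda>v. point_shift) \<tau>"
    unfolding gset_def using int_action_point_shift \<tau>(1,2) by blast
  moreover have "sat (\<lambda>v. point_shift) \<tau> h c" if "c \<in> C" for c
  proof (cases c)
    case (Eq v i k j)
    then have "j = i" "point_shift 0 (h (v, i)) = point_shift k (h (v, i))"
      using sat_Eq that stab.neg by (auto simp: h_eq)
    then show ?thesis using Eq int_action_zero[OF int_action_point_shift] by simp
  next
    case (Edge e i \<alpha> j \<beta>)
    then have "e \<in> E" using that sys by (auto simp: rigid_system_def)
    then show ?thesis using Edge that \<tau>(3) by simp
  qed
  ultimately have "solution (\<lambda>v. point_shift) \<tau> h C" by (simp add: solution_def)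
  then show thesis using that d by (simp add: h_def)
qed

text \<open>Rigidity is applied to the canonical solution. Unknowns over one vertex get the same
  value although distinct ones lie on orbits with different numbers, so there is only one; and its
  value is fixed by all integers, so its derived stabilizer is everything.\<close>

lemma folded_system_stab:
  assumes sys: "rigid_system n U C" and fold: "folded C"
  shows "inj_on fst U" and "u \<in> U \<Longrightarrow> stab C u k"
proof -
  obtain act \<tau> h d where sol: "solution act \<tau> h C" and h: "\<And>v i. h (v, i) = (i, d (v, i), 0)"
    and d: "\<And>u k. stab C u k \<longleftrightarrow> int (d u) dvd k" and act: "\<And>v. act v = point_shift"
    using folded_solution[OF assms] by blast
  have "rigid U C" using sys by (simp add: rigid_system_def)
  then obtain y where y: "\<And>u. u \<in> U \<Longrightarrow> h u = y (fst u)"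
    "\<And>v k. v \<in> V \<Longrightarrow> act v k (y v) = y v"
    by (rule rigidE[OF _ sol]) (rule that)
  show "inj_on fst U"
  proof (rule inj_onI)
    fix u w assume "u \<in> U" "w \<in> U" "fst u = fst w"
    moreover from this have "h u = h w" using y(1) by metis
    ultimately show "u = w" using h by (cases u, cases w) auto
  qed
  show "stab C u k" if "u \<in> U"
  proof -
    have "point_shift k (h u) = h u"
      using y that sys act by (metis imageI rigid_system_def)
    moreover obtain v i where u: "u = (v, i)" by (cases u)
    ultimately have "point_shift k (i, d u, 0) = point_shift 0 (i, d u, 0)"
      using h int_action_zero[OF int_action_point_shift] by simp
    then show ?thesis using d by (simp add: point_shift_base_eq_iff)
  qed
qed

text \<open>Otherwise let everything act trivially except \<open>\<tau> e\<close>, a bijection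
  without fixed points: a constant assignment is then a solution that \<open>e\<close> does not
  fix.\<close>

lemma rigid_system_edge:
  assumes sys: "rigid_system n U C" and e: "e \<in> E"
  obtains i \<alpha> j \<beta> where "Edge e i \<alpha> j \<beta> \<in> C"
proof (rule ccontr)
  assume "\<not> thesis"
  then have no: "Edge e i \<alpha> j \<beta> \<notin> C" for i \<alpha> j \<beta> using that by blast
  let ?act = "\<lambda>v k x. x :: point"
  let ?\<tau> = "\<lambda>f. if f = e then (\<lambda>(c, d, m). (c, d, m + 1)) else (\<lambda>x. x :: point)"
  have "bij (\<lambda>(c, d, m). (c, d, m + 1 :: int) :: point)"
    by (rule o_bij[of "\<lambda>(c, d, m). (c, d, m - 1)"]) auto
  moreover have "bij (\<lambda>x. x :: point)" by (rule bij_id[unfolded id_def])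
  ultimately have "gset ?act ?\<tau>" by (auto simp: gset_def int_action_def)
  moreover have "sat ?act ?\<tau> (\<lambda>u. (0, 0, 0)) c" if "c \<in> C" for c
    using that no by (cases c) auto
  ultimately have sol: "solution ?act ?\<tau> (\<lambda>u. (0, 0, 0)) C" by (simp add: solution_def)
  have "rigid U C" using sys by (simp add: rigid_system_def)
  then obtain y where y: "\<And>u. u \<in> U \<Longrightarrow> (0, 0, 0) = y (fst u)"
    "\<And>f. f \<in> E \<Longrightarrow> ?\<tau> f (y (tgt f)) = y (src f)"
    by (rule rigidE[OF _ sol]) (rule that)
  have "y v = (0, 0, 0)" if "v \<in> V" for v
    using that sys y(1) by (auto simp: rigid_system_def)
  then show False using y(2)[OF e] src_V[OF e] tgt_V[OF e] by simp
qed

text \<open>The condition on the vertex set of a \<open>p\<close>-plateau, written with one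
  orientation per edge. Connectedness is left out, so a union of \<open>p\<close>-plateaus qualifies
  too.\<close>

definition prime_plateau :: "nat \<Rightarrow> 'v set \<Rightarrow> bool" where
  "prime_plateau p Q \<longleftrightarrow> prime p \<and> Q \<noteq> {} \<and> Q \<subseteq> V \<and>
     (\<forall>e\<in>E. (src e \<in> Q \<longrightarrow> int p dvd ls e \<or> tgt e \<in> Q \<and> \<not> int p dvd lt e) \<and>
            (tgt e \<in> Q \<longrightarrow> int p dvd lt e \<or> src e \<in> Q \<and> \<not> int p dvd ls e))"

text \<open>The multiples of \<open>p\<close> over a plateau are closed under all the rules defining \<^const>\<open>stab\<close>.\<close>

lemma prime_plateau_meets_Eq:
  assumes sys: "rigid_system n U C" and fold: "folded C" and Q: "prime_plateau p Q"
  shows "\<exists>v i k j. Eq v i k j \<in> C \<and> v \<in> Q"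
proof (rule ccontr)
  assume no: "\<not> ?thesis"
  have p: "prime (int p)" using Q by (simp add: prime_plateau_def)
  \<comment> \<open>If one end lies outside \<open>Q\<close>, or lies in \<open>Q\<close> with a
    label divisible by \<open>p\<close>, then both sides hold. Otherwise both ends lie in
    \<open>Q\<close> with labels prime to \<open>p\<close>, and both sides say that \<open>p\<close>
    divides \<open>m\<close>.\<close>
  have edge: "(src e \<in> Q \<longrightarrow> int p dvd ls e * m) \<longleftrightarrow> (tgt e \<in> Q \<longrightarrow> int p dvd lt e * m)"
    if "e \<in> E" for e m
    using Q that prime_dvd_mult_iff[OF p] unfolding prime_plateau_def by (metis dvd_mult)
  have "fst u \<in> Q \<longrightarrow> int p dvd k" if "stab C u k" for u k
    using that by induction (use no edge in \<open>fastforce+\<close>)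
  moreover obtain v where "v \<in> Q" "v \<in> V" using Q by (auto simp: prime_plateau_def)
  moreover obtain u where "u \<in> U" "fst u = v"
    using \<open>v \<in> V\<close> sys by (auto simp: rigid_system_def)
  ultimately have "int p dvd 1" using folded_system_stab(2)[OF sys fold, of u 1] by metis
  then show False using p not_prime_unit by blast
qed

text \<open>Once folded, the system has one unknown per vertex and at least one \<open>Edge\<close>
  equation per edge, so the invariant bounds the number of \<open>Eq\<close> equations. Their
  vertices form \<open>S\<close>.\<close>

theorem rigid_system_bound:
  assumes "rigid_system n U C"
  shows "\<exists>S\<subseteq>V. card S + card E + 1 \<le> card V + n \<and>
    (\<forall>p Q. prime_plateau p Q \<longrightarrow> S \<inter> Q \<noteq> {})"
proof -
  obtain U C where sys: "rigid_system n U C" and fold: "folded C"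
    using folded_system_exists[OF assms] .
  have C: "finite C" "\<And>c. c \<in> C \<Longrightarrow> over U c" and U: "fst ` U = V"
    and card: "card C + 1 \<le> card U + n"
    using sys by (auto simp: rigid_system_def)
  define vert where "vert c = (case c of Eq v i k j \<Rightarrow> v | Edge e i \<alpha> j \<beta> \<Rightarrow> src e)" for c :: "('v, 'e) equation"
  define arc where "arc c = (case c of Edge e i \<alpha> j \<beta> \<Rightarrow> e)" for c :: "('v, 'e) equation"
  let ?S = "vert ` {c\<in>C. is_Eq c}"
  have "E \<subseteq> arc ` {c\<in>C. \<not> is_Eq c}"
  proof
    fix e assume "e \<in> E"
    then obtain i \<alpha> j \<beta> where "Edge e i \<alpha> j \<beta> \<in> C" by (rule rigid_system_edge[OF sys])
    then show "e \<in> arc ` {c\<in>C. \<not> is_Eq c}"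
      by (intro image_eqI[of _ _ "Edge e i \<alpha> j \<beta>"]) (auto simp: arc_def)
  qed
  then have "card E \<le> card {c\<in>C. \<not> is_Eq c}" using C(1) by (simp add: surj_card_le)
  moreover have "card ?S \<le> card {c\<in>C. is_Eq c}" using C(1) by (simp add: card_image_le)
  moreover have "card C = card {c\<in>C. is_Eq c} + card {c\<in>C. \<not> is_Eq c}"
    using C(1) by (subst card_Un_disjoint[symmetric]) (auto intro: arg_cong[of _ _ card])
  moreover have "card U = card V"
    using card_image[OF folded_system_stab(1)[OF sys fold]] U by simp
  ultimately have "card ?S + card E + 1 \<le> card V + n" using card by linarith
  moreover have "?S \<subseteq> V"
  proof
    fix v assume "v \<in> ?S"
    then obtain c where "c \<in> C" "is_Eq c" "v = vert c" by auto
    then show "v \<in> V" using C(2)[of c] U by (cases c) (force simp: vert_def)+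
  qed
  moreover have "?S \<inter> Q \<noteq> {}" if Q: "prime_plateau p Q" for p Q
  proof -
    obtain v i k j where "Eq v i k j \<in> C" "v \<in> Q" using prime_plateau_meets_Eq[OF sys fold Q] by blast
    then show ?thesis by (force simp: vert_def intro: image_eqI[of _ _ "Eq v i k j"])
  qed
  ultimately show ?thesis by blast
qed

end

section \<open>Maximal subtrees and the first Betti number\<close>

lemma connected_cut:
  assumes "connected H" and S: "S \<subset> verts H" "S \<noteq> {}"
  obtains e where "e \<in> arcs H" "tail H e \<in> S \<longleftrightarrow> head H e \<notin> S"
proof (rule ccontr)
  assume "\<not> thesis"
  then have no: "tail H e \<in> S \<longleftrightarrow> head H e \<in> S" if "e \<in> arcs H" for e
    using that \<open>\<And>e. e \<in> arcs H \<Longrightarrow> (tail H e \<in> S) = (head H e \<notin> S) \<Longrightarrow> thesis\<close> by blast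
  obtain u w where uw: "u \<in> S" "w \<in> verts H" "w \<notin> S" using S by blast
  then have "(u, w) \<in> rtrancl_on (verts H) (parcs (mk_symmetric H))"
    using assms by (auto simp: connected_def strongly_connected_def reachable_def)
  then have "w \<in> S"
    by (induction rule: rtrancl_on_induct) (use uw no in \<open>auto simp: parcs_mk_symmetric\<close>)
  then show False using uw by simp
qed

section \<open>Trees grown leaf by leaf, and flows on them\<close>

context bidirected_digraph
begin

text \<open>\<open>F\<close> keeps one arc per edge, pointing away from the root, and
  \<open>A\<close> confines the growth to a subgraph. Induction on trees becomes rule induction, the
  newest leaf being the head of the newest arc.\<close>

inductive tree_growth :: "'b set \<Rightarrow> 'a set \<Rightarrow> 'b set \<Rightarrow> bool" for A where
  start: "v \<in> verts G \<Longrightarrow> tree_growth A {v} {}"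
| step: "tree_growth A S F \<Longrightarrow> e \<in> A \<Longrightarrow> e \<in> arcs G \<Longrightarrow> tail G e \<in> S \<Longrightarrow> head G e \<notin> S \<Longrightarrow>
    tree_growth A (insert (head G e) S) (insert e F)"

lemma tree_growth_facts:
  assumes "tree_growth A S F"
  shows "finite S \<and> finite F \<and> F \<subseteq> A \<and> F \<subseteq> arcs G \<and> S \<subseteq> verts G \<and> tail G ` F \<subseteq> S \<and>
    head G ` F \<subseteq> S \<and> card S = card F + 1 \<and> F \<inter> arev ` F = {}"
  using assms
proof induction
  case (step S F e)
  then have "e \<notin> F" "arev e \<notin> F" by (auto simp: image_subset_iff dest!: bspec)
  moreover from this have "e \<notin> arev ` F" by (metis arev_arev imageE)
  ultimately show ?case
    using step arev_neq[of e] by auto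
qed auto

lemma tree_growth_ends:
  assumes "tree_growth A S F" "e \<in> F \<union> arev ` F"
  shows "tail G e \<in> S" "head G e \<in> S"
  using tree_growth_facts[OF assms(1)] assms(2) by (auto simp: image_subset_iff subset_iff)

lemma tree_growth_walk:
  assumes "tree_growth A S F" and H: "wf_digraph H" "tail H = tail G" "head H = head G"
    and sub: "S \<subseteq> verts H" "F \<union> arev ` F \<subseteq> arcs H" and xy: "x \<in> S" "y \<in> S"
  shows "\<exists>p. pre_digraph.awalk H x p y \<and> set p \<subseteq> F \<union> arev ` F"
proof -
  interpret H: wf_digraph H by (rule H)
  from assms(1) sub xy show ?thesis
  proof (induction arbitrary: x y)
    case (start v)
    then show ?case by (intro exI[of _ "[]"]) (auto simp: H.awalk_Nil_iff)
  next
    case (step S F e)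
    let ?F = "insert e F \<union> arev ` insert e F"
    have arc: "H.awalk (tail G e) [e] (head G e)" "H.awalk (head G e) [arev e] (tail G e)"
      using step.prems(2) step.hyps(3) H(2,3)
      by (auto simp: H.awalk_Cons_iff H.awalk_Nil_iff intro: H.head_in_verts H.tail_in_verts)
        (metis H.head_in_verts H.tail_in_verts)+
    have walk_to: "\<exists>p. H.awalk x p (tail G e) \<and> set p \<subseteq> ?F" if x: "x \<in> insert (head G e) S" for x
    proof (cases "x \<in> S")
      case True
      then obtain p where "H.awalk x p (tail G e)" "set p \<subseteq> F \<union> arev ` F"
        using step.IH[of x "tail G e"] step.prems step.hyps by blast
      then show ?thesis by blast
    next
      case False
      then show ?thesis using x arc(2) by auto
    qed
    have walk_from: "\<exists>p. H.awalk (tail G e) p y \<and> set p \<subseteq> ?F" if y: "y \<in> insert (head G e) S" for y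
    proof (cases "y \<in> S")
      case True
      then obtain p where "H.awalk (tail G e) p y" "set p \<subseteq> F \<union> arev ` F"
        using step.IH[of "tail G e" y] step.prems step.hyps by blast
      then show ?thesis by blast
    next
      case False
      then show ?thesis using y arc(1) by auto
    qed
    obtain p q where "H.awalk x p (tail G e)" "set p \<subseteq> ?F" "H.awalk (tail G e) q y" "set q \<subseteq> ?F"
      using walk_to[OF step.prems(3)] walk_from[OF step.prems(4)] by blast
    then show ?case by (intro exI[of _ "p @ q"]) auto
  qed
qed

text \<open>A largest growth inside \<open>T\<close> reaches all vertices, as connectedness supplies
  an arc leaving any proper subset. It exhausts \<open>T\<close>: an arc of \<open>T\<close> closes
  up with a path of the growth to a cycle, and in a Serre tree a cycle is a backtracking, so the arc
  belongs to \<open>F\<close> up to orientation.\<close>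

lemma maximal_subtree_growth:
  assumes T: "maximal_subtree T G arev" and fin: "finite (verts G)"
  obtains F where "tree_growth (arcs T) (verts G) F" "arcs T = F \<union> arev ` F"
proof -
  have sub: "subgraph T G" "arev ` arcs T \<subseteq> arcs T" and V: "verts T = verts G"
    and conn: "connected T" and cyc: "\<And>p. pre_digraph.cycle T p \<Longrightarrow> \<exists>e. p = [e, arev e]"
    using T by (auto simp: maximal_subtree_def serre_subgraph_def spanning_def serre_tree_def)
  have th: "tail T = tail G" "head T = head G"
    using sub(1) compatible_tail[of G T] compatible_head[of G T] unfolding subgraph_def by metis+
  have wfT: "wf_digraph T" and arcsT: "arcs T \<subseteq> arcs G"
    using sub(1) by (simp_all add: subgraph_def)
  interpret T: wf_digraph T by (rule wfT)
  have "verts G \<noteq> {}"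
    using conn by (simp add: connected_def strongly_connected_def flip: V)
  then have ex: "\<exists>S F. tree_growth (arcs T) S F" by (blast intro: tree_growth.start)
  have bound: "card S \<le> card (verts G)" if "tree_growth (arcs T) S F" for S F
    using tree_growth_facts[OF that] by (intro card_mono fin) simp
  obtain S F where SF: "tree_growth (arcs T) S F"
    and max: "\<And>S' F'. tree_growth (arcs T) S' F' \<Longrightarrow> card S' \<le> card S"
  proof -
    let ?P = "\<lambda>k. \<exists>S F. tree_growth (arcs T) S F \<and> card S = k"
    have ex': "\<exists>k. ?P k" using ex by blast
    have "\<forall>k. ?P k \<longrightarrow> k \<le> card (verts G)" using bound by blast
    then have "?P (Greatest ?P)" "\<And>k. ?P k \<Longrightarrow> k \<le> Greatest ?P"
      using GreatestI_ex_nat[OF ex', of "card (verts G)"] Greatest_le_nat[of ?P _ "card (verts G)"]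
      by auto
    then show thesis using that by metis
  qed
  note facts = tree_growth_facts[OF SF]
  have "S = verts G"
  proof (rule ccontr)
    assume "S \<noteq> verts G"
    moreover have "S \<noteq> {}" using facts by auto
    ultimately obtain e where e: "e \<in> arcs T" "tail T e \<in> S \<longleftrightarrow> head T e \<notin> S"
      using connected_cut[OF conn, of S] facts V by auto
    define f where "f = (if tail T e \<in> S then e else arev e)"
    have f: "f \<in> arcs T" "tail G f \<in> S" "head G f \<notin> S"
      using e sub(2) arcsT th by (auto simp: f_def)
    then have "tree_growth (arcs T) (insert (head G f) S) (insert f F)"
      using SF arcsT by (intro tree_growth.step) auto
    then show False using max f(3) facts by fastforce
  qed
  have "arcs T = F \<union> arev ` F"
  proof
    show "F \<union> arev ` F \<subseteq> arcs T" using facts sub(2) by auto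
    show "arcs T \<subseteq> F \<union> arev ` F"
    proof
      fix e assume e: "e \<in> arcs T"
      have ends: "head G e \<in> S" "tail G e \<in> S"
        using head_in_verts tail_in_verts e arcsT \<open>S = verts G\<close> by blast+
      have "S \<subseteq> verts T" "F \<union> arev ` F \<subseteq> arcs T"
        using \<open>S = verts G\<close> V \<open>F \<union> arev ` F \<subseteq> arcs T\<close> by simp_all
      from tree_growth_walk[OF SF wfT th this ends] obtain p
        where p: "T.awalk (head G e) p (tail G e)" "set p \<subseteq> F \<union> arev ` F"
        by (elim exE conjE)
      let ?q = "T.awalk_to_apath p"
      have q: "T.apath (head G e) ?q (tail G e)" "set ?q \<subseteq> F \<union> arev ` F"
        by (rule T.apath_awalk_to_apath[OF p(1)])
          (rule order_trans[OF T.awalk_to_apath_subset[OF p(1)] p(2)])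
      have "T.cycle (e # ?q)"
        unfolding T.cycle_def
        using q(1) e by (intro exI[of _ "tail G e"]) (simp add: T.apath_def T.awalk_Cons_iff th)
      then obtain f where "e # ?q = [f, arev f]" using cyc by blast
      then have "arev e \<in> F \<union> arev ` F" using q(2) by auto
      then show "e \<in> F \<union> arev ` F" by (metis Un_iff arev_arev image_iff)
    qed
  qed
  then show thesis using that SF \<open>S = verts G\<close> by blast
qed

lemma orientation_exists:
  assumes F: "F \<subseteq> arcs G" "F \<inter> arev ` F = {}"
  obtains E where "F \<subseteq> E" "E \<union> arev ` E = arcs G" "E \<inter> arev ` E = {}"
proof -
  \<comment> \<open>A choice from the unordered pair depends on the geometric edge only, so
    \<open>c\<close> takes the same value on an arc of the graph and on its reversal.\<close>
  define c where "c e = (SOME x. x \<in> {e, arev e})" for e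
  define E where "E = F \<union> {e \<in> arcs G - (F \<union> arev ` F). c e = e}"
  have c_in: "c e = e \<or> c e = arev e" for e
    unfolding c_def by (metis insertE insertI1 singletonD someI_ex)
  have c_rev: "c (arev e) = c e" for e
    unfolding c_def by (simp add: insert_commute)
  have Fr: "arev e \<in> F \<longleftrightarrow> e \<in> arev ` F" "arev e \<in> arev ` F \<longleftrightarrow> e \<in> F" for e
    by (metis arev_arev image_iff)+
  have "F \<subseteq> E" by (simp add: E_def)
  moreover have "arcs G \<subseteq> E \<union> arev ` E"
  proof
    fix e assume e: "e \<in> arcs G"
    then have "e \<in> E \<or> arev e \<in> E"
      using c_in[of e] c_rev[of e] Fr[of e] by (auto simp: E_def)
    then show "e \<in> E \<union> arev ` E" by (metis Un_iff arev_arev image_eqI)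
  qed
  moreover have "E \<union> arev ` E \<subseteq> arcs G" using F by (auto simp: E_def)
  moreover have "E \<inter> arev ` E = {}"
  proof (rule ccontr)
    assume "E \<inter> arev ` E \<noteq> {}"
    then obtain e where e: "e \<in> E" "arev e \<in> E" by auto
    then have "e \<in> arcs G" using F by (auto simp: E_def)
    then have "arev e \<noteq> e" by (rule arev_neq)
    then show False using e F Fr[of e] c_rev[of e] by (auto simp: E_def)
  qed
  ultimately show thesis using that by blast
qed

text \<open>A flow with prescribed divergence \<open>b\<close> is found by removing the newest leaf:
  its demand must pass through its only edge and is charged to the neighbour.\<close>

lemma tree_flow_exists:
  fixes b :: "'a \<Rightarrow> rat"
  assumes "tree_growth A S F" and fin: "\<And>v. finite (out_arcs G v)" and "(\<Sum>v\<in>S. b v) = 0"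
  shows "\<exists>f. (\<forall>e. e \<notin> F \<union> arev ` F \<longrightarrow> f e = 0) \<and> (\<forall>e\<in>arcs G. f (arev e) = - f e) \<and>
    (\<forall>v\<in>S. (\<Sum>e\<in>out_arcs G v. f e) = b v)"
  using assms(1,3)
proof (induction arbitrary: b)
  case (start v)
  then show ?case by (intro exI[of _ "\<lambda>_. 0"]) auto
next
  case (step S F e)
  let ?w = "head G e" and ?x = "tail G e"
  note facts = tree_growth_facts[OF step.hyps(1)]
  define b' where "b' = b(?x := b ?x + b ?w)"
  have S: "finite S" "?x \<in> S" "?w \<notin> S" using facts step.hyps by auto
  have "(\<Sum>v\<in>S - {?x}. b' v) = (\<Sum>v\<in>S - {?x}. b v)" by (rule sum.cong) (auto simp: b'_def)
  then have "(\<Sum>v\<in>S. b' v) = b ?w + (\<Sum>v\<in>S. b v)"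
    using sum.remove[OF S(1,2), of b'] sum.remove[OF S(1,2), of b] by (simp add: b'_def)
  also have "\<dots> = 0" using step.prems sum.insert[OF S(1,3), of b] by metis
  finally have "(\<Sum>v\<in>S. b' v) = 0" .
  from step.IH[OF this] obtain f where f: "\<And>a. a \<notin> F \<union> arev ` F \<Longrightarrow> f a = 0"
    "\<And>a. a \<in> arcs G \<Longrightarrow> f (arev a) = - f a" "\<And>v. v \<in> S \<Longrightarrow> (\<Sum>a\<in>out_arcs G v. f a) = b' v"
    by metis
  define g where "g a = f a + ((if a = e then - b ?w else 0) + (if a = arev e then b ?w else 0))" for a
  have ne: "arev e \<noteq> e" using step.hyps arev_neq by blast
  have sum_g: "(\<Sum>a\<in>out_arcs G v. g a) = (\<Sum>a\<in>out_arcs G v. f a) +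
      ((if ?x = v then - b ?w else 0) + (if ?w = v then b ?w else 0))" for v
    using step.hyps by (simp add: g_def sum.distrib sum.delta[OF fin])
  have "(\<Sum>a\<in>out_arcs G ?w. f a) = 0"
  proof (rule sum.neutral, rule ballI)
    fix a assume "a \<in> out_arcs G ?w"
    then have "tail G a \<notin> S" using step.hyps(5) by simp
    then have "a \<notin> F \<union> arev ` F" using tree_growth_ends(1)[OF step.hyps(1)] by blast
    then show "f a = 0" by (rule f(1))
  qed
  then have "(\<Sum>a\<in>out_arcs G v. g a) = b v" if "v \<in> insert ?w S" for v
    using that f(3) step.hyps by (auto simp: sum_g b'_def)
  moreover have "g a = 0" if "a \<notin> insert e F \<union> arev ` insert e F" for a
    using that f(1) by (auto simp: g_def)
  moreover have "g (arev a) = - g a" if "a \<in> arcs G" for a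
    using that f(2) ne by (auto simp: g_def arev_eq_iff)
  ultimately show ?case by (intro exI[of _ g]) blast
qed

text \<open>At the newest leaf all summands but one vanish, so the value on its edge is zero and the
  leaf can be removed.\<close>

lemma tree_flow_unique:
  fixes f :: "'b \<Rightarrow> rat"
  assumes "tree_growth A S F" and fin: "\<And>v. finite (out_arcs G v)"
    and "\<And>e. e \<notin> F \<union> arev ` F \<Longrightarrow> f e = 0"
    and anti: "\<And>e. e \<in> arcs G \<Longrightarrow> f (arev e) = - f e"
    and "\<And>v. v \<in> S \<Longrightarrow> (\<Sum>e\<in>out_arcs G v. f e) = 0"
  shows "f e = 0"
  using assms(1,3,5)
proof (induction arbitrary: e)
  case (step S F a e)
  let ?w = "head G a"
  have "(\<Sum>e\<in>out_arcs G ?w. f e) = (\<Sum>e\<in>out_arcs G ?w. if e = arev a then f e else 0)"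
  proof (rule sum.cong)
    fix e assume e: "e \<in> out_arcs G ?w"
    then have e': "tail G e \<notin> S" using step.hyps by simp
    then have "e \<noteq> a" using step.hyps by blast
    moreover have "e \<notin> F \<union> arev ` F" using e' tree_growth_ends(1)[OF step.hyps(1)] by blast
    ultimately show "f e = (if e = arev a then f e else 0)" using step.prems(1) by auto
  qed simp
  also have "\<dots> = f (arev a)" using step.hyps by (simp add: sum.delta[OF fin])
  finally have "f (arev a) = 0" using step.prems(2) by simp
  then have "f a = 0" using anti step.hyps by simp
  have "f e = 0" if "e \<notin> F \<union> arev ` F" for e
    using that \<open>f (arev a) = 0\<close> \<open>f a = 0\<close> step.prems(1)[of e] by auto
  then show ?case using step.IH step.prems(2) by blast
qed auto

end

text \<open>\<open>F\<close> orients the maximal subtree and \<open>E\<close> the whole graph, so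
  \<open>E - F\<close> has one arc for each geometric edge outside the subtree.\<close>

locale oriented_labelled_graph = labelled_graph \<Gamma> arev lab
  for \<Gamma> :: "('v, 'e) pre_digraph" and arev :: "'e \<Rightarrow> 'e" and lab :: "'e \<Rightarrow> int" +
  fixes T :: "('v, 'e) pre_digraph" and F E :: "'e set"
  assumes growth: "tree_growth (arcs T) (verts \<Gamma>) F" and arcs_T: "arcs T = F \<union> arev ` F"
    and F_E: "F \<subseteq> E" and E_arcs: "E \<union> arev ` E = arcs \<Gamma>" and E_disj: "E \<inter> arev ` E = {}"
begin

lemma F_facts: "finite F" "F \<subseteq> arcs \<Gamma>" "card (verts \<Gamma>) = card F + 1"
  using tree_growth_facts[OF growth] by auto

lemma E_subset: "E \<subseteq> arcs \<Gamma>" and finite_E: "finite E"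
  using E_arcs finite_arcs by (auto intro: finite_subset)

lemma arc_cases:
  assumes "e \<in> arcs \<Gamma>"
  obtains "e \<in> E" | "arev e \<in> E" "e \<notin> E"
  using assms E_arcs by (metis Un_iff arev_arev imageE)

lemma rev_notin_E: "e \<in> E \<Longrightarrow> arev e \<notin> E"
  using E_disj by (metis disjoint_iff image_eqI)

text \<open>The arc \<open>e\<close> is closed up by a flow in the subtree; \<open>b\<close> is the
  divergence that this flow needs in order to cancel the boundary of \<open>e\<close>.\<close>

lemma fundamental_cycle_exists:
  assumes e: "e \<in> E - F"
  shows "\<exists>z. z \<in> one_cycles \<Gamma> arev \<and> (\<forall>e'\<in>E - F. z e' = (if e' = e then 1 else 0))"
proof -
  have eG: "e \<in> arcs \<Gamma>" using e E_subset by auto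
  define b :: "'v \<Rightarrow> rat" where
    "b v = (if v = head \<Gamma> e then 1 else 0) - (if v = tail \<Gamma> e then 1 else 0)" for v
  have fin: "finite (out_arcs \<Gamma> v)" for v by (rule finite_out_arcs)
  have "(\<Sum>v\<in>verts \<Gamma>. b v) = 0"
    using eG finite_verts by (simp add: b_def sum_subtractf sum.delta)
  then obtain f where f: "\<And>a. a \<notin> F \<union> arev ` F \<Longrightarrow> f a = 0"
    "\<And>a. a \<in> arcs \<Gamma> \<Longrightarrow> f (arev a) = - f a" "\<And>v. v \<in> verts \<Gamma> \<Longrightarrow> (\<Sum>a\<in>out_arcs \<Gamma> v. f a) = b v"
    using tree_flow_exists[OF growth fin, of b] by blast
  have ne: "arev e \<noteq> e" using eG arev_neq by blast
  define z where "z a = f a + ((if a = e then 1 else 0) + (if a = arev e then - 1 else 0))" for a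
  have "(\<Sum>a\<in>out_arcs \<Gamma> v. z a) = 0" if "v \<in> verts \<Gamma>" for v
    using f(3)[OF that] eG by (auto simp: z_def b_def sum.distrib sum.delta[OF fin])
  moreover have "z a = 0" if "a \<notin> arcs \<Gamma>" for a
  proof -
    have "a \<notin> F \<union> arev ` F" "a \<noteq> e" "a \<noteq> arev e" using that eG F_facts(2) by auto
    then show ?thesis using f(1) by (simp add: z_def)
  qed
  moreover have "z (arev a) = - z a" if "a \<in> arcs \<Gamma>" for a
    using that f(2) ne by (auto simp: z_def arev_eq_iff)
  ultimately have "z \<in> one_cycles \<Gamma> arev" by (simp add: one_cycles_def)
  moreover have "z e' = (if e' = e then 1 else 0)" if "e' \<in> E - F" for e'
  proof -
    have "e' \<notin> F \<union> arev ` F" using that F_E E_disj by auto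
    moreover have "e' \<noteq> arev e" using that e rev_notin_E by blast
    ultimately show ?thesis using f(1) by (simp add: z_def)
  qed
  ultimately show ?thesis by blast
qed

lemma cycle_eq_zero:
  assumes z: "z \<in> one_cycles \<Gamma> arev" and zero: "\<And>e. e \<in> E - F \<Longrightarrow> z e = 0"
  shows "z e = 0"
proof (rule tree_flow_unique[OF growth finite_out_arcs])
  show "z a = 0" if "a \<notin> F \<union> arev ` F" for a
  proof (cases "a \<in> arcs \<Gamma>")
    case True
    then show ?thesis
    proof (cases rule: arc_cases)
      case 1
      then show ?thesis using that zero by auto
    next
      case 2
      then have "arev a \<in> E - F" using that by (metis DiffI Un_iff arev_arev image_eqI)
      then have "z (arev a) = 0" by (rule zero)
      then show ?thesis using z True by (auto simp: one_cycles_def)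
    qed
  qed (use z in \<open>auto simp: one_cycles_def\<close>)
qed (use z in \<open>auto simp: one_cycles_def\<close>)

text \<open>The fundamental cycles \<open>z e\<close> form a basis dual to the coordinates in
  \<open>E - F\<close>: evaluation there gives independence, and they span because a cycle is
  determined by these coordinates.\<close>

lemma betti_number_eq: "betti_number \<Gamma> arev = card (E - F)"
proof -
  obtain z where z: "\<And>e. e \<in> E - F \<Longrightarrow> z e \<in> one_cycles \<Gamma> arev"
    "\<And>e e'. e \<in> E - F \<Longrightarrow> e' \<in> E - F \<Longrightarrow> z e e' = (if e' = e then 1 else 0)"
    using fundamental_cycle_exists by metis
  have fin: "finite (E - F)" using finite_E by simp
  have inj: "inj_on z (E - F)"
    by (rule inj_onI) (metis z(2) zero_neq_one)
  have sum_z: "(\<Sum>x\<in>z ` (E - F). fun_scale (c x) x) a = (\<Sum>e\<in>E - F. c (z e) * z e a)" for c a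
  proof -
    have "(\<Sum>x\<in>A. fun_scale (c x) x) a = (\<Sum>x\<in>A. c x * x a)" if "finite A" for A
      using that by induction (auto simp: fun_scale_def)
    from this[of "z ` (E - F)"] show ?thesis using fin by (simp add: sum.reindex[OF inj])
  qed
  have sum_z_E: "(\<Sum>e\<in>E - F. c e * z e a) = c a" if "a \<in> E - F" for c a
  proof -
    have "(\<Sum>e\<in>E - F. c e * z e a) = (\<Sum>e\<in>E - F. if a = e then c e else 0)"
      by (rule sum.cong) (use that z(2) in auto)
    then show ?thesis using that fin by simp
  qed
  have "fun_vector_space.dim (one_cycles \<Gamma> arev) = card (z ` (E - F))"
  proof (rule fun_vector_space.dim_unique[OF _ _ _ HOL.refl])
    show "z ` (E - F) \<subseteq> one_cycles \<Gamma> arev" using z(1) by auto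
    show "\<not> fun_vector_space.dependent (z ` (E - F))"
    proof (rule fun_vector_space.independent_if_scalars_zero)
      fix c x assume "(\<Sum>x\<in>z ` (E - F). fun_scale (c x) x) = 0" "x \<in> z ` (E - F)"
      moreover from this obtain e where "e \<in> E - F" "x = z e" by auto
      ultimately show "c x = 0"
        using sum_z[of c e] sum_z_E[of e "\<lambda>e. c (z e)"] by simp
    qed (use fin in simp)
    show "one_cycles \<Gamma> arev \<subseteq> fun_vector_space.span (z ` (E - F))"
    proof
      fix f assume f: "f \<in> one_cycles \<Gamma> arev"
      define g where "g a = f a - (\<Sum>e\<in>E - F. f e * z e a)" for a
      have "g \<in> one_cycles \<Gamma> arev"
      proof -
        have "(\<Sum>a\<in>out_arcs \<Gamma> v. \<Sum>e\<in>E - F. f e * z e a) = 0" if "v \<in> verts \<Gamma>" for v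
          using z(1) that by (subst sum.swap) (simp add: one_cycles_def flip: sum_distrib_left)
        moreover have "(\<Sum>e\<in>E - F. f e * z e (arev a)) = - (\<Sum>e\<in>E - F. f e * z e a)"
          if "a \<in> arcs \<Gamma>" for a
          using z(1) that by (simp add: one_cycles_def flip: sum_negf)
        moreover have "(\<Sum>e\<in>E - F. f e * z e a) = 0" if "a \<notin> arcs \<Gamma>" for a
          using z(1) that by (simp add: one_cycles_def)
        ultimately show ?thesis using f by (auto simp: one_cycles_def g_def sum_subtractf)
      qed
      moreover have "g e = 0" if "e \<in> E - F" for e
        using sum_z_E[OF that, of f] by (simp add: g_def)
      ultimately have "g a = 0" for a by (rule cycle_eq_zero)
      then have "f a = (\<Sum>e\<in>E - F. f e * z e a)" for a by (metis diff_eq_diff_eq diff_self g_def)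
      then have "f = (\<Sum>e\<in>E - F. fun_scale (f e) (z e))"
      proof -
        have "(\<Sum>e\<in>A. fun_scale (f e) (z e)) a = (\<Sum>e\<in>A. f e * z e a)" if "finite A" for A a
          using that by induction (auto simp: fun_scale_def)
        then show ?thesis using fin \<open>\<And>a. f a = _\<close> by (intro ext) metis
      qed
      then show "f \<in> fun_vector_space.span (z ` (E - F))"
        by (metis (no_types, lifting) fun_vector_space.span_base fun_vector_space.span_scale
            fun_vector_space.span_sum image_eqI)
    qed
  qed
  then show ?thesis by (simp add: betti_number_def card_image[OF inj])
qed

end

section \<open>Vertices meeting every plateau generate\<close>

lemma rtrancl_imp_rtrancl_on:
  assumes "(a, b) \<in> R\<^sup>*" "a \<in> W" "\<And>x y. (x, y) \<in> R \<Longrightarrow> x \<in> W \<Longrightarrow> y \<in> W \<and> (x, y) \<in> Q"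
  shows "(a, b) \<in> rtrancl_on W Q \<and> b \<in> W"
  using assms(1)
proof induction
  case (step y z)
  then show ?case using assms(3)[of y z] by (auto intro: rtrancl_on_into_rtrancl_on)
qed (use assms(2) in auto)

context labelled_graph
begin

text \<open>A prime larger than the absolute values of all labels divides none of them. This plateau
  forces a set that meets every plateau to be non-empty.\<close>

lemma whole_graph_plateau:
  assumes conn: "connected \<Gamma>"
  shows "plateau \<Gamma> \<Gamma> arev lab"
proof -
  obtain p where p: "prime p" "(\<Sum>e\<in>arcs \<Gamma>. nat \<bar>lab e\<bar>) < p" using bigger_prime by blast
  have "\<not> int p dvd lab e" if e: "e \<in> arcs \<Gamma>" for e
  proof
    assume "int p dvd lab e"
    then have "int p \<le> \<bar>lab e\<bar>" using lab_nonzero[OF e] by (intro zdvd_imp_le) simp_all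
    moreover have "nat \<bar>lab e\<bar> \<le> (\<Sum>e\<in>arcs \<Gamma>. nat \<bar>lab e\<bar>)"
      using e by (intro member_le_sum) auto
    ultimately show False using p(2) by linarith
  qed
  moreover have "verts \<Gamma> \<noteq> {}" using conn by (simp add: connected_def strongly_connected_def)
  ultimately have "p_plateau p \<Gamma> \<Gamma> arev lab"
    using conn subgraph_refl by (auto simp: p_plateau_def serre_subgraph_def)
  then show ?thesis using p(1) by (auto simp: plateau_def)
qed

text \<open>The vertices where the exponent of \<open>p\<close> in \<open>n\<close> is maximal are closed under the edges whose
  label near the origin is prime to \<open>p\<close>, so that the components of this graph are plateaus.\<close>

lemma max_multiplicity_plateau:
  fixes n :: "'v \<Rightarrow> nat"
  assumes p: "prime p" and n: "\<And>v. v \<in> verts \<Gamma> \<Longrightarrow> n v \<noteq> 0"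
    and edge: "\<And>e k. e \<in> arcs \<Gamma> \<Longrightarrow> int (n (head \<Gamma> e)) dvd lab (arev e) * k \<Longrightarrow>
      int (n (tail \<Gamma> e)) dvd lab e * k"
    and v: "v \<in> verts \<Gamma>" "p dvd n v"
  obtains P where "p_plateau p P \<Gamma> arev lab" "\<And>w. w \<in> verts P \<Longrightarrow> p dvd n w"
proof -
  define M where "M = Max (multiplicity p ` n ` verts \<Gamma>)"
  have fin: "finite (multiplicity p ` n ` verts \<Gamma>)" by simp
  have le_M: "multiplicity p (n w) \<le> M" if "w \<in> verts \<Gamma>" for w
    unfolding M_def using that by (intro Max_ge fin) auto
  have "M \<in> multiplicity p ` n ` verts \<Gamma>" unfolding M_def using v by (intro Max_in fin) auto
  then obtain v1 where v1: "v1 \<in> verts \<Gamma>" "multiplicity p (n v1) = M" by auto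
  have "multiplicity p (n v) \<noteq> 0" using v n[of v] p by (simp add: prime_elem_multiplicity_eq_zero_iff)
  then have M_pos: "M > 0" using le_M[OF v(1)] by simp
  have pp: "prime (int p)" using p by simp
  have key: "multiplicity p (n (head \<Gamma> e)) = M \<and> \<not> int p dvd lab (arev e)"
    if e: "e \<in> arcs \<Gamma>" and mt: "multiplicity p (n (tail \<Gamma> e)) = M" and nd: "\<not> int p dvd lab e" for e
  proof (rule ccontr)
    assume contra: "\<not> ?thesis"
    have vt: "tail \<Gamma> e \<in> verts \<Gamma>" and vh: "head \<Gamma> e \<in> verts \<Gamma>" using e by auto
    let ?m = "multiplicity p (n (head \<Gamma> e))"
    have np: "\<not> is_unit p" using p by (metis not_prime_unit)
    obtain x where x: "n (tail \<Gamma> e) = p ^ M * x" "\<not> p dvd x"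
      using multiplicity_decompose'[of "n (tail \<Gamma> e)" p] n[OF vt] np mt by auto
    obtain y where y: "n (head \<Gamma> e) = p ^ ?m * y" "\<not> p dvd y"
      using multiplicity_decompose'[of "n (head \<Gamma> e)" p] n[OF vh] np by auto
    \<comment> \<open>\<open>y\<close> supplies the part of \<open>n (head \<Gamma> e)\<close> prime
      to \<open>p\<close>. The power \<open>M - 1\<close> is enough for the rest, because either the
      multiplicity at the head is below \<open>M\<close> or \<open>lab (arev e)\<close> contributes
      a factor \<open>p\<close>. At the tail, however, \<open>p ^ M\<close> would have to divide
      \<open>lab e * ?k\<close>, where \<open>lab e\<close>, \<open>x\<close> and \<open>y\<close>
      are prime to \<open>p\<close>.\<close>
    let ?k = "int p ^ (M - 1) * int y * int x"
    have "int p ^ ?m dvd lab (arev e) * int p ^ (M - 1)"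
    proof (cases "?m < M")
      case True
      then have "int p ^ ?m dvd int p ^ (M - 1)" by (intro le_imp_power_dvd) simp
      then show ?thesis by simp
    next
      case False
      then have "?m = M" using le_M[OF vh] by simp
      moreover have "int p dvd lab (arev e)" using contra \<open>?m = M\<close> by simp
      then have "int p * int p ^ (M - 1) dvd lab (arev e) * int p ^ (M - 1)" by (rule mult_dvd_mono) simp
      ultimately show ?thesis using M_pos by (simp flip: power_Suc)
    qed
    then have "int p ^ ?m * int y dvd (lab (arev e) * int p ^ (M - 1)) * int y"
      by (rule mult_dvd_mono) simp
    then have "int (n (head \<Gamma> e)) dvd lab (arev e) * ?k"
      by (subst y(1)) (simp add: mult.assoc[symmetric])
    then have "int (n (tail \<Gamma> e)) dvd lab e * ?k" by (rule edge[OF e])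
    moreover have "int p ^ M dvd int (n (tail \<Gamma> e))" by (simp add: x(1))
    ultimately have "int p ^ M dvd lab e * ?k" by (rule dvd_trans[rotated])
    moreover have "int p ^ M = int p ^ (M - 1) * int p" using M_pos by (simp flip: power_Suc2)
    ultimately have "int p ^ (M - 1) * int p dvd int p ^ (M - 1) * (lab e * int y * int x)"
      by (simp add: ac_simps)
    then have "int p dvd lab e * int y * int x" using p by (simp add: prime_gt_0_nat)
    then show False using nd x(2) y(2) by (simp add: prime_dvd_mult_iff[OF pp])
  qed
  define A where "A = {e \<in> arcs \<Gamma>. \<not> int p dvd lab e \<and> multiplicity p (n (tail \<Gamma> e)) = M}"
  define R where "R = (\<lambda>e. (tail \<Gamma> e, head \<Gamma> e)) ` A"
  \<comment> \<open>Forward reachability suffices: by \<open>key\<close> the reversal of an arc of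
    \<open>A\<close> lies in \<open>A\<close> again, so \<open>W\<close> is a connected
    component.\<close>
  define W where "W = {w. (v1, w) \<in> R\<^sup>*}"
  have W: "w \<in> verts \<Gamma> \<and> multiplicity p (n w) = M" if "w \<in> W" for w
  proof -
    have "(v1, w) \<in> R\<^sup>*" using that by (simp add: W_def)
    then show ?thesis by induction (use v1 key in \<open>auto simp: R_def A_def\<close>)
  qed
  define P where "P = \<lparr>verts = W, arcs = {e \<in> A. tail \<Gamma> e \<in> W}, tail = tail \<Gamma>, head = head \<Gamma>\<rparr>"
  have head_W: "head \<Gamma> e \<in> W" if "e \<in> A" "tail \<Gamma> e \<in> W" for e
    using that by (auto simp: W_def R_def intro: rtrancl_into_rtrancl)
  have arcs_P: "e \<in> arcs P \<longleftrightarrow> e \<in> arcs \<Gamma> \<and> tail \<Gamma> e \<in> W \<and> \<not> int p dvd lab e" for e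
    using W by (auto simp: P_def A_def)
  have "v1 \<in> W" by (simp add: W_def)
  have "connected P"
  proof -
    let ?Q = "parcs (mk_symmetric P)"
    have step: "y \<in> W \<and> (x, y) \<in> ?Q" if xy: "(x, y) \<in> R" "x \<in> W" for x y
    proof -
      obtain e where e: "e \<in> A" "x = tail \<Gamma> e" "y = head \<Gamma> e" using xy by (auto simp: R_def)
      then have "e \<in> arcs P" using xy by (auto simp: P_def)
      then have "(x, y) \<in> ?Q" unfolding parcs_mk_symmetric using e by (auto simp: P_def)
      then show ?thesis using head_W e xy by auto
    qed
    have "converse ?Q = ?Q" by (auto simp: parcs_mk_symmetric)
    then have to: "(v1, w) \<in> rtrancl_on W ?Q" "(w, v1) \<in> rtrancl_on W ?Q" if "w \<in> W" for w
      using that rtrancl_imp_rtrancl_on[OF _ \<open>v1 \<in> W\<close> step, of w] rtrancl_on_converseI[of v1 w W ?Q]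
      by (auto simp: W_def)
    have "pverts (mk_symmetric P) = W" by (simp add: P_def)
    moreover have "(x, y) \<in> rtrancl_on W ?Q" if "x \<in> W" "y \<in> W" for x y
      using that by (intro rtrancl_on_trans[OF to(2) to(1)])
    ultimately show ?thesis
      using \<open>v1 \<in> W\<close> by (auto simp: connected_def strongly_connected_def reachable_def)
  qed
  moreover have "subgraph P \<Gamma>"
  proof (rule subgraphI)
    show "wf_digraph P" using head_W by (auto simp: P_def intro!: wf_digraph.intro)
    show "compatible \<Gamma> P" by (simp add: P_def compatible_def)
  qed (use W arcs_P wf_digraph_axioms in \<open>auto simp: P_def A_def\<close>)
  moreover have "arev ` arcs P \<subseteq> arcs P"
  proof
    fix a assume "a \<in> arev ` arcs P"
    then obtain e where "a = arev e" "e \<in> arcs P" by blast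
    then show "a \<in> arcs P" using key[of e] head_W[of e] W by (auto simp: arcs_P A_def)
  qed
  moreover have "verts P = W" by (simp add: P_def)
  ultimately have "p_plateau p P \<Gamma> arev lab"
    unfolding p_plateau_def serre_subgraph_def using \<open>v1 \<in> W\<close> by (auto simp only: arcs_P)
  moreover have "p dvd n w" if "w \<in> verts P" for w
    using W[of w] that M_pos not_dvd_imp_multiplicity_0[of p "n w"] by (auto simp: P_def)
  ultimately show thesis using that by blast
qed

lemma plateau_cover_divisors:
  fixes n :: "'v \<Rightarrow> nat"
  assumes conn: "connected \<Gamma>" and meets: "\<And>P. plateau P \<Gamma> arev lab \<Longrightarrow> S \<inter> verts P \<noteq> {}"
    and one: "\<And>s. s \<in> S \<Longrightarrow> n s = 1"
    and edge: "\<And>e k. e \<in> arcs \<Gamma> \<Longrightarrow> int (n (head \<Gamma> e)) dvd lab (arev e) * k \<Longrightarrow>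
      int (n (tail \<Gamma> e)) dvd lab e * k"
    and v: "v \<in> verts \<Gamma>"
  shows "n v = 1"
proof (rule ccontr)
  assume "n v \<noteq> 1"
  then obtain p where p: "prime p" "p dvd n v" using prime_factor_nat by blast
  \<comment> \<open>Exponents of \<open>p\<close> in \<open>n\<close> make sense only if
    \<open>n\<close> is nowhere 0. It is 1 on \<open>S\<close>, which is non-empty, and being
    nonzero spreads along edges because labels are nonzero.\<close>
  let ?Z = "{w \<in> verts \<Gamma>. n w \<noteq> 0}"
  obtain s where "s \<in> S" "s \<in> verts \<Gamma>" using meets[OF whole_graph_plateau[OF conn]] by blast
  then have "s \<in> ?Z" using one by simp
  have nonzero: "n (tail \<Gamma> e) \<noteq> 0" if "e \<in> arcs \<Gamma>" "n (head \<Gamma> e) \<noteq> 0" for e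
  proof
    assume "n (tail \<Gamma> e) = 0"
    then have "lab e * int (n (head \<Gamma> e)) = 0"
      using edge[OF that(1), of "int (n (head \<Gamma> e))"] by simp
    then show False using that lab_nonzero[OF that(1)] by simp
  qed
  have "?Z = verts \<Gamma>"
  proof (rule ccontr)
    assume "?Z \<noteq> verts \<Gamma>"
    then obtain e where e: "e \<in> arcs \<Gamma>" "tail \<Gamma> e \<in> ?Z \<longleftrightarrow> head \<Gamma> e \<notin> ?Z"
      using connected_cut[OF conn, of ?Z] \<open>s \<in> ?Z\<close> by blast
    then show False using nonzero[of e] nonzero[of "arev e"] by auto
  qed
  then have n: "n w \<noteq> 0" if "w \<in> verts \<Gamma>" for w using that by blast
  obtain P where P: "p_plateau p P \<Gamma> arev lab" "\<And>w. w \<in> verts P \<Longrightarrow> p dvd n w"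
    using max_multiplicity_plateau[OF p(1) n edge v p(2)] by blast
  then obtain s where "s \<in> S" "s \<in> verts P" using meets p(1) unfolding plateau_def by blast
  then have "p dvd 1" using P(2) one by metis
  then show False using p(1) by (metis not_prime_unit)
qed

end

context oriented_labelled_graph
begin

section \<open>Generators and relations of the fundamental group\<close>

definition \<G> where "\<G> = gbs_graph_of_groups \<Gamma> arev lab"

abbreviation "pi1 \<equiv> fundamental_group \<G> T"
abbreviation "vert_gen v k \<equiv> gog_class \<G> T [VLetter v k]"
abbreviation "edge_gen e \<equiv> gog_class \<G> T [ELetter e]"

lemma \<G>_simps [simp]: "base \<G> = \<Gamma>" "brev \<G> = arev" "vgroup \<G> v = integer_group"
  "egroup \<G> e = integer_group" "incl \<G> e = (\<lambda>n. lab e * n)"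
  by (simp_all add: \<G>_def gbs_graph_of_groups_def)

lemma group_pi1: "group pi1"
  using graph_of_groups.group_fundamental_group graph_of_groups_gbs unfolding \<G>_def by blast

sublocale pi1: group "fundamental_group \<G> T" by (rule group_pi1)

lemma carrier_pi1: "carrier pi1 = gog_class \<G> T ` gog_words \<G>"
  and one_pi1: "\<one>\<^bsub>pi1\<^esub> = gog_class \<G> T []"
  by (simp_all add: fundamental_group_def)

lemma words_Cons: "l # w \<in> gog_words \<G> \<longleftrightarrow> [l] \<in> gog_words \<G> \<and> w \<in> gog_words \<G>"
  by (simp add: gog_words_def)

lemma words_letter: "[VLetter v k] \<in> gog_words \<G> \<longleftrightarrow> v \<in> verts \<Gamma>" "[ELetter e] \<in> gog_words \<G> \<longleftrightarrow> e \<in> arcs \<Gamma>"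
  by (auto simp: gog_words_def)

lemma vert_gen_carrier: "v \<in> verts \<Gamma> \<Longrightarrow> vert_gen v k \<in> carrier pi1"
  and edge_gen_carrier: "e \<in> arcs \<Gamma> \<Longrightarrow> edge_gen e \<in> carrier pi1"
  unfolding carrier_pi1 by (auto simp: words_letter)

lemma class_eqI: "gog_relation \<G> T u w \<Longrightarrow> gog_class \<G> T u = gog_class \<G> T w"
  by (simp add: gog_class_eq_iff gog_cong.base)

lemma class_Cons: "gog_class \<G> T (l # w) = gog_class \<G> T [l] \<otimes>\<^bsub>pi1\<^esub> gog_class \<G> T w"
  by (simp add: fundamental_group_mult)

lemma vert_gen_add: "v \<in> verts \<Gamma> \<Longrightarrow> vert_gen v (j + k) = vert_gen v j \<otimes>\<^bsub>pi1\<^esub> vert_gen v k"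
  using class_eqI[OF gog_relation.vertex_mult[of v \<G> j k T]]
  by (simp add: fundamental_group_mult integer_group_def)

lemma vert_gen_zero: "v \<in> verts \<Gamma> \<Longrightarrow> vert_gen v 0 = \<one>\<^bsub>pi1\<^esub>"
  using class_eqI[OF gog_relation.vertex_one[of v \<G> T]] by (simp add: one_pi1 integer_group_def)

lemma vert_gen_uminus: "v \<in> verts \<Gamma> \<Longrightarrow> vert_gen v (- k) = inv\<^bsub>pi1\<^esub> vert_gen v k"
  using vert_gen_add[of v "- k" k] vert_gen_zero[of v]
  by (intro pi1.inv_equality[symmetric]) (simp_all add: vert_gen_carrier)

lemma edge_gen_arev: "e \<in> arcs \<Gamma> \<Longrightarrow> edge_gen (arev e) = inv\<^bsub>pi1\<^esub> edge_gen e"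
  using class_eqI[OF gog_relation.edge_inverse[of "arev e" \<G> T]]
  by (intro pi1.inv_equality[symmetric])
    (simp_all add: edge_gen_carrier fundamental_group_mult one_pi1)

lemma edge_gen_F: "e \<in> F \<Longrightarrow> edge_gen e = \<one>\<^bsub>pi1\<^esub>"
  using class_eqI[OF gog_relation.tree_edge[of e T \<G>]] arcs_T by (simp add: one_pi1)

lemma edge_conj:
  assumes "e \<in> arcs \<Gamma>"
  shows "vert_gen (tail \<Gamma> e) (lab e * k) =
    edge_gen e \<otimes>\<^bsub>pi1\<^esub> (vert_gen (head \<Gamma> e) (lab (arev e) * k) \<otimes>\<^bsub>pi1\<^esub> edge_gen (arev e))"
  using class_eqI[OF gog_relation.edge_conj[of e \<G> k T]] assms
  by (simp add: integer_group_def fundamental_group_mult)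

lemma subgroup_eq_carrier:
  assumes H: "subgroup H pi1" and v: "\<And>v. v \<in> verts \<Gamma> \<Longrightarrow> vert_gen v 1 \<in> H"
    and e: "\<And>e. e \<in> arcs \<Gamma> \<Longrightarrow> edge_gen e \<in> H"
  shows "H = carrier pi1"
proof
  show "H \<subseteq> carrier pi1" using H by (rule subgroup.subset)
  have nat_power: "vert_gen v (int m) \<in> H" if "v \<in> verts \<Gamma>" for v m
  proof (induction m)
    case 0
    show ?case using vert_gen_zero[OF that] subgroup.one_closed[OF H] by simp
  next
    case (Suc m)
    have "vert_gen v (int (Suc m)) = vert_gen v 1 \<otimes>\<^bsub>pi1\<^esub> vert_gen v (int m)"
      using vert_gen_add[OF that, of 1 "int m"] by simp
    then show ?case using Suc v[OF that] subgroup.m_closed[OF H] by metis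
  qed
  have power: "vert_gen v k \<in> H" if "v \<in> verts \<Gamma>" for v k
  proof (cases "k \<ge> 0")
    case True
    then show ?thesis using nat_power[OF that, of "nat k"] by simp
  next
    case False
    then show ?thesis
      using nat_power[OF that, of "nat (- k)"] vert_gen_uminus[OF that, of "- k"]
        subgroup.m_inv_closed[OF H] by simp
  qed
  have "gog_class \<G> T w \<in> H" if "w \<in> gog_words \<G>" for w
    using that
  proof (induction w)
    case Nil
    then show ?case using subgroup.one_closed[OF H] by (simp add: one_pi1)
  next
    case (Cons l w)
    have "[l] \<in> gog_words \<G>" using Cons.prems words_Cons[of l w] by blast
    then have "gog_class \<G> T [l] \<in> H" using power e by (cases l) (auto simp: words_letter)
    then show ?case
      using Cons subgroup.m_closed[OF H] unfolding class_Cons[of l w] words_Cons[of l w] by blast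
  qed
  then show "carrier pi1 \<subseteq> H" by (auto simp: carrier_pi1)
qed

text \<open>Stable letters of the subtree are trivial, so \<open>H\<close> contains all of them.
  Conjugation by \<open>e\<close> then carries a power in \<open>H\<close> of the generator at the
  head, if it comes from the edge group, to the corresponding power at the tail; this is the
  divisibility condition in \<open>plateau_cover_divisors\<close>.\<close>

lemma plateau_cover_generates:
  assumes conn: "connected \<Gamma>" and S: "S \<subseteq> verts \<Gamma>"
    and meets: "\<And>P. plateau P \<Gamma> arev lab \<Longrightarrow> S \<inter> verts P \<noteq> {}"
  shows "(\<lambda>v. vert_gen v 1) ` S \<union> edge_gen ` (E - F) \<subseteq> carrier pi1"
    and "generate pi1 ((\<lambda>v. vert_gen v 1) ` S \<union> edge_gen ` (E - F)) = carrier pi1"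
proof -
  let ?X = "(\<lambda>v. vert_gen v 1) ` S \<union> edge_gen ` (E - F)"
  show X: "?X \<subseteq> carrier pi1" using S E_subset vert_gen_carrier edge_gen_carrier by blast
  define H where "H = generate pi1 ?X"
  have H: "subgroup H pi1" unfolding H_def by (rule pi1.generate_is_subgroup[OF X])
  have X_H: "?X \<subseteq> H" unfolding H_def by (auto intro: generate.incl)
  note closed = subgroup.m_closed[OF H] subgroup.m_inv_closed[OF H] subgroup.one_closed[OF H]
  have E_H: "edge_gen e \<in> H" if "e \<in> E" for e
    using that X_H edge_gen_F[of e] closed(3) by (cases "e \<in> F") auto
  have edge_H: "edge_gen e \<in> H" if "e \<in> arcs \<Gamma>" for e
    using that
  proof (cases rule: arc_cases)
    case 2
    then show ?thesis using E_H[of "arev e"] edge_gen_arev[of "arev e"] closed(2) that by simp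
  qed (rule E_H)
  have conj_H: "vert_gen (tail \<Gamma> e) (lab e * k) \<in> H"
    if "e \<in> arcs \<Gamma>" "vert_gen (head \<Gamma> e) (lab (arev e) * k) \<in> H" for e k
    unfolding edge_conj[OF that(1)] using that edge_H by (intro closed) auto
  have "\<exists>d. \<forall>k. vert_gen v k \<in> H \<longleftrightarrow> int d dvd k" if "v \<in> verts \<Gamma>" for v
    by (rule int_subgroup_multiples[of "{k. vert_gen v k \<in> H}"])
      (auto simp: vert_gen_zero[OF that] vert_gen_add[OF that] vert_gen_uminus[OF that] closed)
  then obtain n where n: "\<And>v k. v \<in> verts \<Gamma> \<Longrightarrow> vert_gen v k \<in> H \<longleftrightarrow> int (n v) dvd k" by metis
  have "n v = 1" if "v \<in> verts \<Gamma>" for v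
  proof (rule plateau_cover_divisors[OF conn meets _ _ that])
    fix s assume "s \<in> S"
    then have "int (n s) dvd 1" using n[of s 1] S X_H by auto
    then show "n s = 1" by simp
  next
    fix e k assume "e \<in> arcs \<Gamma>" "int (n (head \<Gamma> e)) dvd lab (arev e) * k"
    then show "int (n (tail \<Gamma> e)) dvd lab e * k" using conj_H[of e k] n by auto
  qed
  then have "vert_gen v 1 \<in> H" if "v \<in> verts \<Gamma>" for v using n that by simp
  then show "generate pi1 ?X = carrier pi1"
    using subgroup_eq_carrier[OF H] edge_H unfolding H_def by blast
qed

end

section \<open>From generating words to a system of equations\<close>

lemma (in bidirected_digraph) tree_growth_const:
  assumes "tree_growth A S F" "\<And>e. e \<in> F \<Longrightarrow> g (tail G e) = g (head G e)" "x \<in> S" "y \<in> S"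
  shows "g x = g y"
  using assms
proof (induction arbitrary: x y)
  case (step S F e)
  have "g z = g (tail G e)" if "z \<in> insert (head G e) S" for z
  proof (cases "z \<in> S")
    case True
    then show ?thesis using step.IH[of z "tail G e"] step.hyps step.prems(1) by simp
  next
    case False
    then show ?thesis using that step.prems(1)[of e] by simp
  qed
  then show ?case using step.prems(2,3) by metis
qed simp

text \<open>A tree carries no monodromy: the bijection at a new leaf is not yet constrained and is
  dictated by its edge.\<close>

lemma (in bidirected_digraph) tree_growth_trivialize:
  fixes \<tau> :: "'b \<Rightarrow> 'x \<Rightarrow> 'x"
  assumes "tree_growth A S F" "\<And>e. e \<in> F \<Longrightarrow> bij (\<tau> e)"
  shows "\<exists>\<sigma> :: 'a \<Rightarrow> 'x \<Rightarrow> 'x. (\<forall>v. bij (\<sigma> v)) \<and> (\<forall>e\<in>F. \<forall>x. \<sigma> (head G e) x = \<sigma> (tail G e) (\<tau> e x))"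
  using assms
proof induction
  case (start v)
  have "bij (\<lambda>x :: 'x. x)" by (rule bij_id[unfolded id_def])
  then show ?case by (intro exI[of _ "\<lambda>_ x. x"]) simp
next
  case (step S F e)
  have "bij (\<tau> f)" if "f \<in> F" for f using step.prems that by blast
  from step.IH[OF this] obtain \<sigma> :: "'a \<Rightarrow> 'x \<Rightarrow> 'x" where \<sigma>: "\<And>v. bij (\<sigma> v)"
    "\<And>f x. f \<in> F \<Longrightarrow> \<sigma> (head G f) x = \<sigma> (tail G f) (\<tau> f x)"
    by blast
  let ?\<sigma> = "\<sigma>(head G e := \<sigma> (tail G e) \<circ> \<tau> e)"
  have ends: "tail G f \<noteq> head G e" "head G f \<noteq> head G e" if "f \<in> F" for f
  proof -
    have "tail G f \<in> S" "head G f \<in> S" using tree_growth_ends[OF step.hyps(1)] that by simp_all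
    then show "tail G f \<noteq> head G e" "head G f \<noteq> head G e" using step.hyps(5) by metis+
  qed
  have "bij (\<sigma> (tail G e) \<circ> \<tau> e)" using \<sigma>(1) step.prems by (intro bij_comp) auto
  then have "bij (?\<sigma> v)" for v using \<sigma>(1) by simp
  moreover have "tail G e \<noteq> head G e" using step.hyps(4,5) by metis
  then have "?\<sigma> (head G f) x = ?\<sigma> (tail G f) (\<tau> f x)" if "f \<in> insert e F" for f x
    using that \<sigma>(2) ends by (cases "f = e") simp_all
  ultimately show ?case by blast
qed

lemma (in oriented_labelled_graph) verts_nonempty: "verts \<Gamma> \<noteq> {}"
  using F_facts(3) by auto

sublocale oriented_labelled_graph \<subseteq>
  EL: edge_labels "verts \<Gamma>" E "tail \<Gamma>" "head \<Gamma>" lab "\<lambda>e. lab (arev e)"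
  using E_subset lab_nonzero by unfold_locales auto

text \<open>The bijections \<open>\<sigma>\<close> identify the sets over the vertices in such a way that the edges of the
  maximal subtree act trivially; words then act on the common set.\<close>

locale word_action = oriented_labelled_graph \<Gamma> arev lab T F E
  for \<Gamma> :: "('v, 'e) pre_digraph" and arev :: "'e \<Rightarrow> 'e" and lab :: "'e \<Rightarrow> int" and T F E +
  fixes act :: "'v \<Rightarrow> int \<Rightarrow> point \<Rightarrow> point" and \<tau> :: "'e \<Rightarrow> point \<Rightarrow> point"
    and \<sigma> :: "'v \<Rightarrow> point \<Rightarrow> point"
  assumes gset: "EL.gset act \<tau>" and bij_\<sigma>: "bij (\<sigma> v)"
    and \<sigma>_F: "e \<in> F \<Longrightarrow> \<sigma> (head \<Gamma> e) x = \<sigma> (tail \<Gamma> e) (\<tau> e x)"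
begin

lemma inv_\<sigma> [simp]: "the_inv (\<sigma> v) (\<sigma> v x) = x" "\<sigma> v (the_inv (\<sigma> v) x) = x"
  using bij_\<sigma>[of v] by (simp_all add: the_inv_f_f bij_is_inj f_the_inv_into_f_bij_betw)

lemma inv_\<tau>: "e \<in> E \<Longrightarrow> the_inv (\<tau> e) (\<tau> e x) = x" "e \<in> E \<Longrightarrow> \<tau> e (the_inv (\<tau> e) x) = x"
proof -
  have bij: "bij (\<tau> e)" if "e \<in> E" using gset that unfolding EL.gset_def by blast
  show "e \<in> E \<Longrightarrow> the_inv (\<tau> e) (\<tau> e x) = x" "e \<in> E \<Longrightarrow> \<tau> e (the_inv (\<tau> e) x) = x"
    using bij by (simp_all add: the_inv_f_f bij_is_inj f_the_inv_into_f_bij_betw)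
qed

text \<open>An arc carries the set over its head to the set over its tail, so an arc outside
  \<open>E\<close> acts by the inverse of \<open>\<tau>\<close> of its reversal. In
  \<open>eval\<close> the last letter acts first, and concatenation becomes composition.\<close>

fun eval_letter :: "('v, 'e, int) letter \<Rightarrow> point \<Rightarrow> point" where
  "eval_letter (VLetter v k) x = \<sigma> v (act v k (the_inv (\<sigma> v) x))"
| "eval_letter (ELetter e) x = \<sigma> (tail \<Gamma> e)
     ((if e \<in> E then \<tau> e else the_inv (\<tau> (arev e))) (the_inv (\<sigma> (head \<Gamma> e)) x))"

definition eval :: "('v, 'e, int) letter list \<Rightarrow> point \<Rightarrow> point" where
  "eval w = foldr eval_letter w"

lemma eval_simps [simp]: "eval [] x = x" "eval (l # w) x = eval_letter l (eval w x)"
  "eval (u @ w) x = eval u (eval w x)"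
  by (simp_all add: eval_def)

lemma eval_edge_rev:
  assumes "e \<in> arcs \<Gamma>"
  shows "eval_letter (ELetter e) (eval_letter (ELetter (arev e)) x) = x"
  using assms
proof (cases rule: arc_cases)
  case 1
  then show ?thesis using assms rev_notin_E[OF 1] by (simp add: inv_\<tau>)
next
  case 2
  then show ?thesis using assms by (simp add: inv_\<tau>)
qed

lemma eval_edge_conj:
  assumes "e \<in> arcs \<Gamma>"
  shows "eval_letter (ELetter e) (eval_letter (VLetter (head \<Gamma> e) (lab (arev e) * k)) x) =
    eval_letter (VLetter (tail \<Gamma> e) (lab e * k)) (eval_letter (ELetter e) x)"
  using assms
proof (cases rule: arc_cases)
  case 1
  then show ?thesis using EL.gset_eqv[OF gset 1] by simp
next
  case 2
  let ?y = "the_inv (\<sigma> (head \<Gamma> e)) x"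
  have "\<tau> (arev e) (act (tail \<Gamma> e) (lab e * k) (the_inv (\<tau> (arev e)) ?y)) =
      act (head \<Gamma> e) (lab (arev e) * k) ?y"
    using EL.gset_eqv[OF gset 2(1), of k "the_inv (\<tau> (arev e)) ?y"] assms 2 by (simp add: inv_\<tau>)
  then have "act (tail \<Gamma> e) (lab e * k) (the_inv (\<tau> (arev e)) ?y) =
      the_inv (\<tau> (arev e)) (act (head \<Gamma> e) (lab (arev e) * k) ?y)"
    using inv_\<tau>(1)[OF 2(1)] by metis
  then show ?thesis using 2 by simp
qed

lemma eval_relation:
  assumes "gog_relation \<G> T u w"
  shows "eval u = eval w"
  using assms
proof cases
  case (vertex_mult v g h)
  then show ?thesis
    using int_action_add[OF EL.gset_action[OF gset]] by (auto simp: fun_eq_iff integer_group_def)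
next
  case (vertex_one v)
  then show ?thesis
    using int_action_zero[OF EL.gset_action[OF gset]] by (auto simp: fun_eq_iff integer_group_def)
next
  case (edge_inverse e)
  then show ?thesis using eval_edge_rev[of e] by (auto simp: fun_eq_iff simp del: eval_letter.simps)
next
  case (edge_conj e c)
  then show ?thesis
    using eval_edge_conj[of e c] eval_edge_rev[of e]
    by (auto simp: fun_eq_iff simp del: eval_letter.simps)
next
  case (tree_edge e)
  then consider "e \<in> F" | "e \<notin> E" "arev e \<in> F"
    using arcs_T F_E rev_notin_E by auto
  then show ?thesis
  proof cases
    case 1
    then show ?thesis using tree_edge F_E \<sigma>_F[of e] by (auto simp: fun_eq_iff simp flip: \<sigma>_F)
  next
    case 2
    then have "e \<in> arcs \<Gamma>" using F_facts(2) by (metis arev_arev arev_in_arcs subsetD)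
    moreover have "\<sigma> (tail \<Gamma> e) (the_inv (\<tau> (arev e)) y) = \<sigma> (head \<Gamma> e) y" for y
    proof -
      have "\<tau> (arev e) (the_inv (\<tau> (arev e)) y) = y" using 2 F_E inv_\<tau>(2) by blast
      then show ?thesis
        using \<sigma>_F[OF 2(2), of "the_inv (\<tau> (arev e)) y"] \<open>e \<in> arcs \<Gamma>\<close> by simp
    qed
    ultimately show ?thesis using tree_edge 2 by (auto simp: fun_eq_iff)
  qed
qed

lemma eval_cong:
  assumes "gog_cong \<G> T u w"
  shows "eval u = eval w"
  using assms by induction (auto simp: eval_relation intro!: ext simp del: split_paired_All)

lemma eval_class: "gog_class \<G> T u = gog_class \<G> T w \<Longrightarrow> eval u = eval w"
  using eval_cong by (simp add: gog_class_eq_iff)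

text \<open>The elements fixing \<open>x\<close> form a subgroup. Only words act, so every element
  is handled through representatives; \<open>eval_class\<close> makes their choice
  immaterial.\<close>

lemma eval_generate:
  assumes X: "X \<subseteq> carrier pi1" and fixed: "\<And>w. gog_class \<G> T w \<in> X \<Longrightarrow> eval w x = x"
    and "g \<in> generate pi1 X" "g = gog_class \<G> T w"
  shows "eval w x = x"
  using assms(3,4)
proof (induction arbitrary: w)
  case one
  then have "eval [] = eval w" by (intro eval_class) (simp add: one_pi1)
  then show ?case by (metis eval_simps(1))
next
  case (incl h)
  then show ?case using fixed by blast
next
  case (inv h)
  then obtain u where u: "h = gog_class \<G> T u" "h \<in> carrier pi1" using X by (auto simp: carrier_pi1)
  then have "gog_class \<G> T (w @ u) = gog_class \<G> T []"
    using inv.prems by (metis pi1.l_inv fundamental_group_mult one_pi1)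
  then have "eval (w @ u) = eval []" by (rule eval_class)
  then have "eval w (eval u x) = x" by (metis eval_simps(1,3))
  moreover have "eval u x = x" using fixed u(1) inv.hyps by blast
  ultimately show ?case by simp
next
  case (eng h1 h2)
  then have "h1 \<in> carrier pi1" "h2 \<in> carrier pi1" using pi1.generate_in_carrier[OF X] by auto
  then obtain u1 u2 where u: "h1 = gog_class \<G> T u1" "h2 = gog_class \<G> T u2" by (auto simp: carrier_pi1)
  then have "eval w = eval (u1 @ u2)" using eng.prems by (intro eval_class) (simp add: fundamental_group_mult)
  then show ?case using eng.IH u by simp
qed

lemma inj_eval_letter:
  assumes "[l] \<in> gog_words \<G>"
  shows "eval_letter l x = eval_letter l y \<longleftrightarrow> x = y"
proof (cases l)
  case (VLetter v k)
  then show ?thesis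
    using EL.act_inj[OF gset] by (metis eval_letter.simps(1) inv_\<sigma>)
next
  case (ELetter e)
  then have "arev e \<in> arcs \<Gamma>" using assms by (simp add: words_letter)
  then show ?thesis using eval_edge_rev[of "arev e"] ELetter by (metis arev_arev)
qed

end

section \<open>The system of equations attached to a generating set\<close>

context oriented_labelled_graph
begin

text \<open>As the last letter of a word acts first, the letter at position \<open>p\<close> leads
  from the unknowns at \<open>Suc p\<close> to those at \<open>p\<close>. For an arc outside
  \<open>E\<close> the equation is that of its reversal, read the other way.\<close>

fun letter_equation :: "nat \<Rightarrow> ('v, 'e, int) letter \<Rightarrow> ('v, 'e) equation" where
  "letter_equation p (VLetter v k) = Eq v (Suc p) k p"
| "letter_equation p (ELetter e) = (if e \<in> E then Edge e p 0 (Suc p) 0 else Edge (arev e) (Suc p) 0 p 0)"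

text \<open>The letters of all the words are read one after the other, each one leading from one copy of
  the maximal subtree to the next; after each word the base point is the initial one again.\<close>

definition word_system :: "'v \<Rightarrow> ('v, 'e, int) letter list list \<Rightarrow> ('v, 'e) equation set" where
  "word_system r ws = (let L = concat ws in
     (\<lambda>(e, p). Edge e p 0 p 0) ` (F \<times> {..length L}) \<union>
     (\<lambda>p. letter_equation p (L ! p)) ` {..<length L} \<union>
     (\<lambda>q. Eq r 0 0 (length (concat (take q ws)))) ` {1..length ws})"

lemma length_concat_take: "length (concat (take q ws)) \<le> length (concat ws)"
  by (metis append_take_drop_id concat_append length_append le_add1)

lemma word_system_over:
  assumes r: "r \<in> verts \<Gamma>" and ws: "set ws \<subseteq> gog_words \<G>" and c: "c \<in> word_system r ws"
  shows "EL.over (verts \<Gamma> \<times> {..length (concat ws)}) c"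
proof -
  have "[l] \<in> gog_words \<G>" if "l \<in> set (concat ws)" for l
    using that ws by (auto simp: gog_words_def)
  then have "EL.over (verts \<Gamma> \<times> {..length (concat ws)}) (letter_equation p (concat ws ! p))"
    if "p < length (concat ws)" for p
    using nth_mem[OF that] that E_subset
    by (cases "concat ws ! p") (fastforce simp: words_letter elim: arc_cases)+
  moreover have "e \<in> E" "tail \<Gamma> e \<in> verts \<Gamma>" "head \<Gamma> e \<in> verts \<Gamma>" if "e \<in> F" for e
    using that F_E F_facts(2) by auto
  ultimately show ?thesis
    using c r length_concat_take unfolding word_system_def Let_def by auto
qed

text \<open>Let \<open>l\<close> be the total length. There are \<open>l + 1\<close> copies of a
  tree with \<open>card F\<close> edges, \<open>l\<close> letters, and one closing equation per
  word. Since \<open>card F * (l + 1) + l + 1\<close> is the number of unknowns, the excess is at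
  most the number of words.\<close>

lemma card_word_system:
  "finite (word_system r ws) \<and>
   card (word_system r ws) + 1 \<le> card (verts \<Gamma> \<times> {..length (concat ws)}) + length ws"
proof -
  let ?l = "length (concat ws)"
  let ?A = "(\<lambda>(e, p). Edge e p 0 p 0) ` (F \<times> {..?l}) :: ('v, 'e) equation set"
  let ?B = "(\<lambda>p. letter_equation p (concat ws ! p)) ` {..<?l}"
  let ?C = "(\<lambda>q. Eq r 0 0 (length (concat (take q ws)))) ` {1..length ws} :: ('v, 'e) equation set"
  have "card ?A \<le> card F * (?l + 1)"
    using card_image_le[of "F \<times> {..?l}"] F_facts(1) by (simp add: card_cartesian_product)
  moreover have "card ?B \<le> ?l" using card_image_le[of "{..<?l}"] by simp
  moreover have "card ?C \<le> length ws" using card_image_le[of "{1..length ws}"] by simp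
  moreover have "card (?A \<union> ?B \<union> ?C) \<le> card ?A + card ?B + card ?C"
    using card_Un_le[of "?A \<union> ?B" ?C] card_Un_le[of ?A ?B] by linarith
  ultimately have "card (?A \<union> ?B \<union> ?C) + 1 \<le> (card F + 1) * (?l + 1) + length ws" by simp
  then show ?thesis
    using F_facts by (simp add: word_system_def Let_def card_cartesian_product)
qed

text \<open>In a solution, the tree equations turn the values on each copy into one point
  \<open>b p\<close> of the common set, the letters link consecutive copies, and the closing
  equations return to \<open>b 0\<close>. Hence each word fixes \<open>b 0\<close>, and so does the
  whole group; as letters act injectively, all \<open>b p\<close> coincide.\<close>

lemma word_system_rigid:
  assumes r: "r \<in> verts \<Gamma>" and ws: "set ws \<subseteq> gog_words \<G>"
    and X: "X \<subseteq> gog_class \<G> T ` set ws" and gen: "generate pi1 X = carrier pi1"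
  shows "EL.rigid (verts \<Gamma> \<times> {..length (concat ws)}) (word_system r ws)"
  unfolding EL.rigid_def
proof (intro allI impI)
  fix act \<tau> h assume sol: "EL.solution act \<tau> h (word_system r ws)"
  then have g: "EL.gset act \<tau>" by (simp add: EL.solution_def)
  let ?L = "concat ws" and ?U = "verts \<Gamma> \<times> {..length (concat ws)}"
  have bij_\<tau>: "bij (\<tau> e)" if "e \<in> F" for e using g that F_E unfolding EL.gset_def by blast
  have "\<exists>\<sigma> :: 'v \<Rightarrow> point \<Rightarrow> point. (\<forall>v. bij (\<sigma> v)) \<and> (\<forall>e\<in>F. \<forall>x. \<sigma> (head \<Gamma> e) x = \<sigma> (tail \<Gamma> e) (\<tau> e x))"
    by (rule tree_growth_trivialize[OF growth]) (rule bij_\<tau>)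
  then obtain \<sigma> :: "'v \<Rightarrow> point \<Rightarrow> point" where
    "\<And>v. bij (\<sigma> v)" "\<And>e x. e \<in> F \<Longrightarrow> \<sigma> (head \<Gamma> e) x = \<sigma> (tail \<Gamma> e) (\<tau> e x)"
    by blast
  then interpret word_action \<Gamma> arev lab T F E act \<tau> \<sigma>
    using g by unfold_locales
  note act0 = int_action_zero[OF EL.gset_action[OF g]]
  have sat: "EL.sat act \<tau> h c" if "c \<in> word_system r ws" for c
    using sol that by (simp add: EL.solution_def)
  define b where "b p = \<sigma> r (h (r, p))" for p
  have b: "\<sigma> v (h (v, p)) = b p" if v: "v \<in> verts \<Gamma>" and p: "p \<le> length ?L" for v p
    unfolding b_def
  proof (rule tree_growth_const[OF growth _ v r])
    fix e assume e: "e \<in> F"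
    then have "Edge e p 0 p 0 \<in> word_system r ws"
      using p by (force simp: word_system_def Let_def)
    then have "\<tau> e (h (head \<Gamma> e, p)) = h (tail \<Gamma> e, p)" using sat by (fastforce simp: act0)
    then show "\<sigma> (tail \<Gamma> e) (h (tail \<Gamma> e, p)) = \<sigma> (head \<Gamma> e) (h (head \<Gamma> e, p))"
      using \<sigma>_F[OF e] by simp
  qed
  have L_words: "[?L ! p] \<in> gog_words \<G>" if "p < length ?L" for p
    using nth_mem[OF that] ws by (auto simp: gog_words_def)
  have letter: "b p = eval_letter (?L ! p) (b (Suc p))" if p: "p < length ?L" for p
  proof -
    have s: "EL.sat act \<tau> h (letter_equation p (?L ! p))"
      by (rule sat) (use p in \<open>auto simp: word_system_def Let_def\<close>)
    show ?thesis
    proof (cases "?L ! p")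
      case (VLetter v k)
      then have "v \<in> verts \<Gamma>" using L_words[OF p] by (simp add: words_letter)
      then show ?thesis
        using s VLetter b[of v p] b[of v "Suc p"] p by (auto simp flip: b)
    next
      case (ELetter e)
      then have e: "e \<in> arcs \<Gamma>" using L_words[OF p] by (simp add: words_letter)
      then have bp: "b p = \<sigma> (tail \<Gamma> e) (h (tail \<Gamma> e, p))"
        "b (Suc p) = \<sigma> (head \<Gamma> e) (h (head \<Gamma> e, Suc p))"
        using b p by auto
      from e show ?thesis
      proof (cases rule: arc_cases)
        case 1
        then show ?thesis using s ELetter by (simp add: bp act0)
      next
        case 2
        then have "h (head \<Gamma> e, Suc p) = \<tau> (arev e) (h (tail \<Gamma> e, p))"
          using s ELetter e by (simp add: act0)
        then show ?thesis using 2 ELetter by (simp add: bp inv_\<tau>)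
      qed
    qed
  qed
  have segment: "b p = eval (take m (drop p ?L)) (b (p + m))" if "p + m \<le> length ?L" for p m
    using that
  proof (induction m arbitrary: p)
    case (Suc m)
    then have "drop p ?L = ?L ! p # drop (Suc p) ?L" by (intro Cons_nth_drop_Suc[symmetric]) simp
    then show ?case using Suc.IH[of "Suc p"] Suc.prems letter[of p] by simp
  qed simp
  have closing: "b (length (concat (take q ws))) = b 0" if "q \<le> length ws" for q
  proof (cases "q = 0")
    case False
    then have "Eq r 0 0 (length (concat (take q ws))) \<in> word_system r ws"
      using that by (auto simp: word_system_def Let_def)
    then show ?thesis using sat by (fastforce simp: act0 b_def)
  qed simp
  have fixed_ws: "eval w (b 0) = b 0" if w: "w \<in> set ws" for w
  proof -
    obtain q where q: "q < length ws" "ws ! q = w" using w by (auto simp: in_set_conv_nth)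
    \<comment> \<open>The word \<open>w\<close> occupies the positions between the lengths of two
      consecutive prefixes, and \<open>closing\<close> identifies the points at both ends with
      \<open>b 0\<close>.\<close>
    have "concat ws = concat (take q ws) @ w @ concat (drop (Suc q) ws)"
      using q by (metis concat.simps(2) concat_append id_take_nth_drop)
    moreover have "concat (take (Suc q) ws) = concat (take q ws) @ w"
      using q by (simp add: take_Suc_conv_app_nth)
    ultimately have "b (length (concat (take q ws))) = eval w (b (length (concat (take (Suc q) ws))))"
      using segment[of "length (concat (take q ws))" "length w"] by simp
    then show ?thesis using closing[of q] closing[of "Suc q"] q by simp
  qed
  have fixed_X: "eval w (b 0) = b 0" if w: "gog_class \<G> T w \<in> X" for w
  proof -
    obtain u where u: "u \<in> set ws" "gog_class \<G> T w = gog_class \<G> T u" using w X by blast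
    show ?thesis using fixed_ws[OF u(1)] eval_class[OF u(2)] by metis
  qed
  have X_carrier: "X \<subseteq> carrier pi1" using X ws unfolding carrier_pi1 by blast
  have fixed: "eval w (b 0) = b 0" if w: "w \<in> gog_words \<G>" for w
  proof (rule eval_generate[OF X_carrier fixed_X])
    show "gog_class \<G> T w \<in> generate pi1 X" using w by (simp add: gen carrier_pi1)
  qed simp_all
  have b_const: "b p = b 0" if "p \<le> length ?L" for p
    using that
  proof (induction p)
    case (Suc p)
    then have "eval_letter (?L ! p) (b (Suc p)) = eval_letter (?L ! p) (b 0)"
      using letter[of p] fixed[OF L_words[of p]] by simp
    then show ?case using inj_eval_letter L_words Suc.prems by simp
  qed simp
  define y where "y v = the_inv (\<sigma> v) (b 0)" for v
  have y_eqI: "x = y v" if "\<sigma> v x = b 0" for v x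
    using inv_\<sigma>(1)[of v x] that by (simp add: y_def)
  have "h u = y (fst u)" if u: "u \<in> ?U" for u
  proof -
    obtain v p where vp: "u = (v, p)" "v \<in> verts \<Gamma>" "p \<le> length ?L" using u by auto
    have "\<sigma> v (h (v, p)) = b 0" using b[OF vp(2,3)] b_const[OF vp(3)] by (rule HOL.trans)
    then show ?thesis using y_eqI vp(1) by simp
  qed
  moreover have "act v k (y v) = y v" if "v \<in> verts \<Gamma>" for v k
    using fixed[of "[VLetter v k]"] that by (intro y_eqI) (simp add: words_letter y_def)
  moreover have "\<tau> e (y (head \<Gamma> e)) = y (tail \<Gamma> e)" if "e \<in> E" for e
  proof -
    have "[ELetter e] \<in> gog_words \<G>" using that E_subset by (auto simp: words_letter)
    then show ?thesis using fixed[of "[ELetter e]"] that by (intro y_eqI) (simp add: y_def)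
  qed
  ultimately show "\<exists>y. (\<forall>u\<in>?U. h u = y (fst u)) \<and> (\<forall>v\<in>verts \<Gamma>. \<forall>k. act v k (y v) = y v) \<and>
      (\<forall>e\<in>E. \<tau> e (y (head \<Gamma> e)) = y (tail \<Gamma> e))"
    by blast
qed

text \<open>The condition at the target of an edge is the condition at the origin of the reversed
  arc.\<close>

lemma plateau_imp_prime_plateau:
  assumes "p_plateau p P \<Gamma> arev lab" "prime p"
  shows "EL.prime_plateau p (verts P)"
proof -
  have P: "serre_subgraph P \<Gamma> arev" "verts P \<noteq> {}"
    "\<And>e. e \<in> arcs \<Gamma> \<Longrightarrow> tail \<Gamma> e \<in> verts P \<Longrightarrow> int p dvd lab e \<longleftrightarrow> e \<notin> arcs P"
    using assms(1) by (auto simp: p_plateau_def)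
  have sub: "verts P \<subseteq> verts \<Gamma>" "arcs P \<subseteq> arcs \<Gamma>" "wf_digraph P" "tail P = tail \<Gamma>" "head P = head \<Gamma>"
    and rev: "\<And>e. e \<in> arcs P \<Longrightarrow> arev e \<in> arcs P"
    using P(1) compatible_tail[of \<Gamma> P] compatible_head[of \<Gamma> P]
    unfolding serre_subgraph_def subgraph_def by (blast, blast, blast, metis, metis, blast)
  have edge: "int p dvd lab e \<or> head \<Gamma> e \<in> verts P \<and> \<not> int p dvd lab (arev e)"
    if e: "e \<in> arcs \<Gamma>" "tail \<Gamma> e \<in> verts P" for e
  proof (cases "e \<in> arcs P")
    case True
    then have "head \<Gamma> e \<in> verts P" using sub wf_digraph.head_in_verts by metis
    moreover from this have "\<not> int p dvd lab (arev e)" using P(3)[of "arev e"] rev[OF True] e by simp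
    ultimately show ?thesis by simp
  qed (use P(3) e in simp)
  have "e \<in> arcs \<Gamma>" if "e \<in> E" for e using that E_subset by blast
  then show ?thesis
    using P(2) sub(1) assms(2) edge edge[of "arev _"] unfolding EL.prime_plateau_def
    by (metis arev_arev arev_in_arcs head_arev tail_arev)
qed

text \<open>The subtree has one edge fewer than vertices, so
  \<open>card E - card (verts \<Gamma>) + 1\<close> is \<open>card (E - F)\<close>, and the bound
  for rigid systems takes the wanted form.\<close>

lemma card_generating_set_ge:
  assumes X: "X \<subseteq> carrier pi1" "finite X" and gen: "generate pi1 X = carrier pi1"
  shows "\<exists>S\<subseteq>verts \<Gamma>. card S + card (E - F) \<le> card X \<and>
    (\<forall>P. plateau P \<Gamma> arev lab \<longrightarrow> S \<inter> verts P \<noteq> {})"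
proof -
  obtain r where r: "r \<in> verts \<Gamma>" using verts_nonempty by blast
  have "\<forall>x\<in>X. \<exists>w\<in>gog_words \<G>. x = gog_class \<G> T w" using X(1) by (auto simp: carrier_pi1)
  then obtain word where word: "\<And>x. x \<in> X \<Longrightarrow> word x \<in> gog_words \<G> \<and> x = gog_class \<G> T (word x)" by metis
  obtain xs where xs: "set xs = X" "distinct xs" using finite_distinct_list[OF X(2)] by blast
  let ?ws = "map word xs"
  have ws: "set ?ws \<subseteq> gog_words \<G>" "X \<subseteq> gog_class \<G> T ` set ?ws" using word xs by auto
  have n: "length ?ws = card X" using xs distinct_card by fastforce
  let ?U = "verts \<Gamma> \<times> {..length (concat ?ws)}"
  have "EL.rigid_system (card X) ?U (word_system r ?ws)"
    unfolding EL.rigid_system_def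
    using word_system_over[OF r ws(1)] card_word_system[of r ?ws]
      word_system_rigid[OF r ws gen] n by auto
  from EL.rigid_system_bound[OF this]
  obtain S where S: "S \<subseteq> verts \<Gamma>" "card S + card E + 1 \<le> card (verts \<Gamma>) + card X"
    "\<And>p Q. EL.prime_plateau p Q \<Longrightarrow> S \<inter> Q \<noteq> {}"
    by (elim exE conjE) (rule that, blast+)
  have "card E = card F + card (E - F)"
    using card_Un_disjoint[of F "E - F"] F_E finite_E F_facts(1) by (simp add: Un_absorb1)
  then have "card S + card (E - F) \<le> card X" using S(2) F_facts(3) by simp
  then show ?thesis
    using S(1,3) plateau_imp_prime_plateau unfolding plateau_def by blast
qed

theorem group_rank_fundamental_group:
  assumes conn: "connected \<Gamma>"
  shows "group_rank pi1 = enat (betti_number \<Gamma> arev + plateau_number \<Gamma> arev lab)"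
proof -
  let ?meets = "\<lambda>S. \<forall>P. plateau P \<Gamma> arev lab \<longrightarrow> S \<inter> verts P \<noteq> {}"
  let ?cover = "\<lambda>n. \<exists>S \<subseteq> verts \<Gamma>. finite S \<and> card S = n \<and> ?meets S"
  \<comment> \<open>The set of all vertices is a candidate, so the \<open>LEAST\<close> in
    \<open>plateau_number\<close> is attained.\<close>
  have "verts \<Gamma> \<inter> verts P \<noteq> {}" if "plateau P \<Gamma> arev lab" for P
    using that by (auto simp: plateau_def p_plateau_def serre_subgraph_def subgraph_def)
  then have "?cover (card (verts \<Gamma>))" by auto
  then have "?cover (plateau_number \<Gamma> arev lab)"
    unfolding plateau_number_def by (rule LeastI)
  then obtain S where S: "S \<subseteq> verts \<Gamma>" "finite S" "card S = plateau_number \<Gamma> arev lab" "?meets S"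
    by blast
  have least: "plateau_number \<Gamma> arev lab \<le> card S'" if "S' \<subseteq> verts \<Gamma>" "?meets S'" for S'
    unfolding plateau_number_def
    by (rule Least_le) (use that finite_subset[OF that(1)] in auto)
  let ?X = "(\<lambda>v. vert_gen v 1) ` S \<union> edge_gen ` (E - F)"
  have X: "?X \<subseteq> carrier pi1" "generate pi1 ?X = carrier pi1" "finite ?X"
    using plateau_cover_generates[OF conn S(1)] S finite_E by auto
  have "card ?X \<le> card ((\<lambda>v. vert_gen v 1) ` S) + card (edge_gen ` (E - F))" by (rule card_Un_le)
  also have "\<dots> \<le> card S + card (E - F)"
    using S(2) finite_E by (intro add_mono card_image_le) auto
  finally have "card ?X \<le> betti_number \<Gamma> arev + plateau_number \<Gamma> arev lab"
    using S(3) by (simp add: betti_number_eq)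
  then have "group_rank pi1 \<le> enat (betti_number \<Gamma> arev + plateau_number \<Gamma> arev lab)"
    unfolding group_rank_def using X by (intro INF_lower2[of ?X]) auto
  moreover have "enat (betti_number \<Gamma> arev + plateau_number \<Gamma> arev lab) \<le> group_rank pi1"
    unfolding group_rank_def
  proof (rule INF_greatest)
    fix Y assume "Y \<in> {S. S \<subseteq> carrier pi1 \<and> generate pi1 S = carrier pi1}"
    then have Y: "Y \<subseteq> carrier pi1" "generate pi1 Y = carrier pi1" by auto
    show "enat (betti_number \<Gamma> arev + plateau_number \<Gamma> arev lab) \<le> (if finite Y then enat (card Y) else \<infinity>)"
    proof (cases "finite Y")
      case True
      then obtain S' where "S' \<subseteq> verts \<Gamma>" "card S' + card (E - F) \<le> card Y" "?meets S'"
        using card_generating_set_ge[OF Y(1) _ Y(2)] by blast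
      then show ?thesis using least[of S'] True by (simp add: betti_number_eq)
    qed simp
  qed
  ultimately show ?thesis by (rule antisym)
qed

end

lemma iso_group_rank_le:
  assumes "group G" "group H" "G \<cong> H"
  shows "group_rank H \<le> group_rank G"
  unfolding group_rank_def
proof (rule INF_mono)
  fix S assume "S \<in> {S. S \<subseteq> carrier G \<and> generate G S = carrier G}"
  then have S: "S \<subseteq> carrier G" "generate G S = carrier G" by auto
  obtain f where f: "f \<in> iso G H" using assms(3) by (auto simp: is_iso_def)
  then interpret f: group_hom G H f
    using assms by (simp add: group_hom_def group_hom_axioms_def iso_def)
  have img: "f ` carrier G = carrier H" using f by (simp add: iso_def bij_betw_def)
  have "generate H (f ` S) = carrier H" using f.generate_img[OF S(1)] S(2) img by simp
  moreover have "f ` S \<subseteq> carrier H" using S(1) img by blast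
  ultimately show "\<exists>S'\<in>{S. S \<subseteq> carrier H \<and> generate H S = carrier H}.
      (if finite S' then enat (card S') else \<infinity>) \<le> (if finite S then enat (card S) else \<infinity>)"
    by (intro bexI[of _ "f ` S"]) (auto simp: card_image_le)
qed

text \<open>Rank is invariant under isomorphism, so only the fundamental group matters; the given
  subtree yields \<open>F\<close>, and any orientation extending \<open>F\<close> serves as
  \<open>E\<close>.\<close>

theorem theorem1p1:
  fixes \<Gamma> :: "('v, 'e) pre_digraph"
    and arev :: "'e \<Rightarrow> 'e"
    and lab :: "'e \<Rightarrow> int"
    and G :: "('a, 'b) monoid_scheme"
  assumes "labelled_graph \<Gamma> arev lab"
    and "connected \<Gamma>"
    and "group G"
    and "represented_by G \<Gamma> arev lab"
  shows "group_rank G = enat (betti_number \<Gamma> arev + plateau_number \<Gamma> arev lab)"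
proof -
  interpret labelled_graph \<Gamma> arev lab by fact
  obtain T where T: "maximal_subtree T \<Gamma> arev"
    and iso: "G \<cong> fundamental_group (gbs_graph_of_groups \<Gamma> arev lab) T"
    using assms(4) by (auto simp: represented_by_def)
  obtain F where F: "tree_growth (arcs T) (verts \<Gamma>) F" "arcs T = F \<union> arev ` F"
    using maximal_subtree_growth[OF T] by auto
  then have "F \<subseteq> arcs \<Gamma>" "F \<inter> arev ` F = {}" using tree_growth_facts[OF F(1)] by auto
  then obtain E where "F \<subseteq> E" "E \<union> arev ` E = arcs \<Gamma>" "E \<inter> arev ` E = {}"
    by (rule orientation_exists)
  with F interpret oriented_labelled_graph \<Gamma> arev lab T F E by unfold_locales
  have iso: "G \<cong> pi1" using iso by (simp add: \<G>_def)
  then have "pi1 \<cong> G" by (rule group.iso_sym[OF assms(3)])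
  then have "group_rank G = group_rank pi1"
    using iso iso_group_rank_le[OF assms(3) pi1.is_group] iso_group_rank_le[OF pi1.is_group assms(3)]
    by (simp add: antisym)
  then show ?thesis using group_rank_fundamental_group[OF assms(2)] by simp
qed

end
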